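(* (a) Let $n\in\mathbb{N}$ with $n\geq 7$, and let $\langle A\mid R\rangle$ be any monoid presentation for the symmetric group $S_n$, with associated surjective homomorphism $\pi:A^*\to S_n$ (so that $\ker\pi=R^{\sharp}$). Let $\zeta\notin A$ be a new letter. Define permutations $\alpha,\beta\in S_n$ by: $\alpha=(3,4)$ and $\beta=(3,4,\ldots,n)$ if $n$ is odd; $\alpha=(3,4,\ldots,n)$ and $\beta=(3,7,6,4,5)$ if $n$ is even. Then the full transformation monoid $T_n$ is defined by the monoid presentation with generators $A\cup\{\zeta\}$ and relations $R$ together with the following $4$ relations: $$(1,n)(2,3)\,\zeta\,(1,n)(2,3)\,\zeta=\zeta\,(1,n)(2,3)\,\zeta\,(1,n)(2,3),$$ $$(2,3)\,\zeta\,(2,3)\,\zeta\,(2,3)\,\zeta\,(2,3)=\zeta\,(2,3)\,\zeta,$$ $$\alpha^{-1}\,\zeta\,\alpha=\zeta\,(1,3)\,\zeta\,(1,3),$$ $$\beta^{-1}\,\zeta\,\beta=(1,2)\,\zeta\,(1,3)\,\zeta\,(1,3),$$ where the permutations (including $\alpha^{\pm1}$ and $\beta^{\pm1}$) denote any words in $A^*$ representing them under $\pi$, and the letter $\zeta$ represents the idempotent of rank $n-1$ in $T_n$ mapping $2$ to $1$ (and fixing every other point). (b) Furthermore, every monoid presentation for $T_n$, $n\geq 4$, requires at least $4$ non-$S_n$ relations; that is, if $n\geq 4$ and $\langle A,B\mid R,S\rangle$ is a monoid presentation for $T_n$, where $\langle A\mid R\rangle$ is a monoid presentation for the symmetric group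 $S_n\leq T_n$, then $|S|\geq 4$.
   Context: Maps act on the right and are composed from left to right: $(x)(fg)=((x)f)g$. $T_n$ is the monoid of all maps $\{1,\ldots,n\}\to\{1,\ldots,n\}$ under composition; the rank of an element is the size of its image. Its group of units is $S_n$. Permutations are written in disjoint cycle notation. A (monoid) presentation is a pair $\langle X\mid Q\rangle$ with $X$ an alphabet and $Q\subseteq X^*\times X^*$; only finite presentations are considered. It defines the quotient $X^*/Q^{\sharp}$, where $Q^{\sharp}$ is the least congruence on the free monoid $X^*$ containing $Q$. Saying that a monoid $M$ is defined by $\langle X\mid Q\rangle$, where each letter represents a specified element of $M$, means that the homomorphism $X^*\to M$ sending each letter to the element it represents is surjective with kernel $Q^{\sharp}$. In (a), each letter of $A$ represents its image under $\pi$. The notation $\langle A,B\mid R,S\rangle$ means $\langle A\cup B\mid R\cup S\rangle$, with $A\cap B=\varnothing$ and $R\subseteq A^*\times A^*$. In (b), if $\phi:(A\cup B)^*\to T_n$ is the surjective homomorphism associated to the presentation of $T_n$, then "$\langle A\mid R\rangle$ is a monoid presentation for $S_n\leq T_n$" means that the restriction of $\phi$ to $A^*$ has image $S_n$ and kernel equal to the congruence on $A^*$ generated by $R$. The relations in $S$ are called the non-$S_n$ relations. *)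

theory Defs
  imports "HOL-Combinatorics.Cycles" "HOL-Algebra.Group"
begin

text \<open>
  A transformation of \<open>{1..n}\<close> is encoded as a function on \<open>nat\<close> that maps \<open>{1..n}\<close> into
  itself and is the identity outside, which is the convention of \<^const>\<open>permutes\<close>.
  Maps act on the right and are composed from left to right, so the product of \<open>f\<close> and \<open>g\<close>
  is \<open>g \<circ> f\<close>. (The group \<open>sym_group\<close> of HOL-Algebra composes in the opposite order.)
\<close>

definition full_transf_monoid :: "nat \<Rightarrow> (nat \<Rightarrow> nat) monoid" where
  "full_transf_monoid n =
     \<lparr> carrier = {f. f ` {1..n} \<subseteq> {1..n} \<and> (\<forall>x. x \<notin> {1..n} \<longrightarrow> f x = x)},
       mult = (\<lambda>f g. g \<circ> f), one = id \<rparr>"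

definition symmetric_group :: "nat \<Rightarrow> (nat \<Rightarrow> nat) monoid" where
  "symmetric_group n = (full_transf_monoid n) \<lparr> carrier := {p. p permutes {1..n}} \<rparr>"

text \<open>
  The free monoid on an alphabet \<open>X\<close> is \<open>lists X\<close> under concatenation.
\<close>

definition word_congruence :: "'x set \<Rightarrow> ('x list \<times> 'x list) set \<Rightarrow> bool" where
  "word_congruence X E \<longleftrightarrow>
     equiv (lists X) E \<and>
     (\<forall>u v u' v'. (u, v) \<in> E \<and> (u', v') \<in> E \<longrightarrow> (u @ u', v @ v') \<in> E)"

text \<open>
  The least congruence containing \<open>Q\<close>; meaningful only if \<open>Q \<subseteq> lists X \<times> lists X\<close>.
\<close>

definition generated_congruence ::
  "'x set \<Rightarrow> ('x list \<times> 'x list) set \<Rightarrow> ('x list \<times> 'x list) set" where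
  "generated_congruence X Q = \<Inter>{E. word_congruence X E \<and> Q \<subseteq> E}"

text \<open>
  The homomorphism from the free monoid to \<open>M\<close> that extends the assignment \<open>\<rho>\<close> of
  elements of \<open>M\<close> to letters.
\<close>

definition word_value :: "('m, 'z) monoid_scheme \<Rightarrow> ('x \<Rightarrow> 'm) \<Rightarrow> 'x list \<Rightarrow> 'm" where
  "word_value M \<rho> w = foldr (\<lambda>x m. \<rho> x \<otimes>\<^bsub>M\<^esub> m) w \<one>\<^bsub>M\<^esub>"

text \<open>
  \<open>M\<close> is defined by the finite presentation \<open>\<langle>X | Q\<rangle>\<close>, where the letter \<open>x\<close> represents
  \<open>\<rho> x\<close>. The values of \<open>\<rho>\<close> outside \<open>X\<close> are irrelevant.
\<close>

definition monoid_presentation ::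
  "('m, 'z) monoid_scheme \<Rightarrow> 'x set \<Rightarrow> ('x list \<times> 'x list) set \<Rightarrow> ('x \<Rightarrow> 'm) \<Rightarrow> bool" where
  "monoid_presentation M X Q \<rho> \<longleftrightarrow>
     finite X \<and> finite Q \<and> Q \<subseteq> lists X \<times> lists X \<and>
     \<rho> ` X \<subseteq> carrier M \<and>
     word_value M \<rho> ` lists X = carrier M \<and>
     {(u, v). u \<in> lists X \<and> v \<in> lists X \<and> word_value M \<rho> u = word_value M \<rho> v}
       = generated_congruence X Q"

definition words_for ::
  "('m, 'z) monoid_scheme \<Rightarrow> 'x set \<Rightarrow> ('x \<Rightarrow> 'm) \<Rightarrow> 'm \<Rightarrow> 'x list set" where
  "words_for M X \<rho> m = {w \<in> lists X. word_value M \<rho> w = m}"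

text \<open>
  All concatenations \<open>w\<^sub>1 @ \<dots> @ w\<^sub>k\<close> with \<open>w\<^sub>i\<close> in the \<open>i\<close>-th set of words. With the sets
  \<^const>\<open>words_for\<close>, this lets every occurrence of an element be replaced by an arbitrary word
  representing it, independently of its other occurrences.
\<close>

definition word_products :: "'x list set list \<Rightarrow> 'x list set" where
  "word_products Ls = concat ` listset Ls"

definition alpha :: "nat \<Rightarrow> nat \<Rightarrow> nat" where
  "alpha n = (if odd n then cycle_of_list [3, 4] else cycle_of_list [3..<n + 1])"

definition beta :: "nat \<Rightarrow> nat \<Rightarrow> nat" where
  "beta n = (if odd n then cycle_of_list [3..<n + 1] else cycle_of_list [3, 7, 6, 4, 5])"

definition zeta_map :: "nat \<Rightarrow> nat" where
  "zeta_map = id(2 := 1)"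

end

theory Submission
  imports Defs
begin

text \<open>
  (a) Write \<open>e\<close> for \<open>\<zeta>\<close> and \<open>s\<close> for \<open>(1,2)\<close>. Put \<open>X = (1,3) e (1,3)\<close>. The last two relations say that
  conjugating \<open>e\<close> by \<open>\<alpha>\<close> gives \<open>e X\<close> and conjugating it by \<open>\<beta>\<close> gives \<open>s e X\<close>, hence conjugating \<open>e\<close> by
  \<open>\<beta> \<alpha>\<inverse>\<close> gives \<open>s e\<close>. As \<open>X\<close> is fixed by the permutations of \<open>{4..n}\<close> that fix \<open>e\<close>, the centralizer
  of \<open>e\<close> in the symmetric group on \<open>{3..n}\<close> grows until it contains the alternating group. Now \<open>\<alpha>\<close> is
  odd and \<open>\<beta>\<close> is even, so odd permutations of \<open>{3..n}\<close> conjugate \<open>e\<close> to \<open>s e = e X\<close>, and a short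
  computation gives \<open>e e = e = s e\<close>. The conjugates of \<open>e\<close> then satisfy the commutation and absorption
  laws of the idempotents of rank \<open>n - 1\<close>, which bring every word into a normal form: a commuting
  product of such idempotents, determined by the kernel of the map, followed by a permutation.

  (b) The kernel of the shortest singular prefix of a word can be changed only by a relation whose value
  has rank at most \<open>n - 2\<close>; this forces one relation whose kernel has two classes of size 2 and
  one whose kernel has a class of size 3. On words of rank \<open>n - 1\<close>, the parity of the unit letters and the
  number of singular letters give an invariant in \<open>\<int>/2 \<times> \<int>\<close>; as this group is not cyclic, two relations of
  rank \<open>n - 1\<close> are needed.
\<close>

subsection \<open>Permutations and cycles\<close>

abbreviation pinv :: "('a \<Rightarrow> 'a) \<Rightarrow> 'a \<Rightarrow> 'a" where
  "pinv p \<equiv> inv_into UNIV p"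

lemma permutes_pinv_apply:
  assumes "p permutes S"
  shows "p (pinv p x) = x" "pinv p (p x) = x" "p \<circ> pinv p = id" "pinv p \<circ> p = id"
  using permutes_inverses[OF assms] permutes_inv_o[OF assms] by auto

lemma permutes_pinv_eqI: "p permutes S \<Longrightarrow> p y = x \<Longrightarrow> pinv p x = y"
  using permutes_inverses(2) by fastforce

lemma conj_transpose:
  assumes "p permutes S"
  shows "p \<circ> transpose a b \<circ> pinv p = transpose (p a) (p b)"
proof
  fix x
  obtain y where "x = p y"
    using permutes_inverses(1)[OF assms, of x] by metis
  moreover have "inj p" using assms by (rule permutes_inj)
  ultimately show "(p \<circ> transpose a b \<circ> pinv p) x = transpose (p a) (p b) x"
    by (auto simp: permutes_pinv_apply[OF assms] transpose_def inj_eq)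
qed

lemma conj_transpose_pinv:
  assumes "p permutes S"
  shows "pinv p \<circ> transpose a b \<circ> p = transpose (pinv p a) (pinv p b)"
  using conj_transpose[OF permutes_inv[OF assms], of a b] permutes_inv_inv[OF assms] by simp

lemma pinv_comp:
  assumes "p permutes S" "q permutes S"
  shows "pinv (p \<circ> q) = pinv q \<circ> pinv p"
  using assms by (meson o_inv_distrib permutes_bij)

section \<open>Cycles: their action and their parity\<close>

lemma cycle_of_list_nth:
  assumes "distinct cs" "i < length cs"
  shows "cycle_of_list cs (cs ! i) = cs ! (Suc i mod length cs)"
proof -
  have "map (cycle_of_list cs) cs = rotate 1 cs"
    using cyclic_rotation[OF assms(1), of 1] by simp
  hence "map (cycle_of_list cs) cs ! i = rotate 1 cs ! i" by simp
  thus ?thesis using nth_rotate[OF assms(2), of 1] assms(2) by (simp add: add.commute)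
qed

lemma evenperm_cycle_of_list:
  "distinct cs \<Longrightarrow> cs \<noteq> [] \<Longrightarrow> evenperm (cycle_of_list cs) \<longleftrightarrow> odd (length cs)"
proof (induction cs rule: cycle_of_list.induct)
  case (1 i j cs)
  have "evenperm (cycle_of_list (i # j # cs))
      \<longleftrightarrow> evenperm (transpose i j) = evenperm (cycle_of_list (j # cs))"
    using evenperm_comp[OF permutation_swap_id permutation_of_cycle] by simp
  moreover have "evenperm (cycle_of_list (j # cs)) \<longleftrightarrow> even (length cs)"
    using 1 by simp
  ultimately show ?case using 1(2) by (simp add: evenperm_swap del: cycle_of_list.simps)
qed simp_all

lemma cycle_of_list_upt:
  assumes "a < b"
  shows "cycle_of_list [a..<Suc b] x = (if a \<le> x \<and> x < b then x + 1 else if x = b then a else x)"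
proof (cases "x \<in> {a..b}")
  case True
  have "cycle_of_list [a..<Suc b] ([a..<Suc b] ! (x - a))
      = [a..<Suc b] ! (Suc (x - a) mod length [a..<Suc b])"
    using True by (intro cycle_of_list_nth) auto
  moreover have "Suc (x - a) mod (Suc b - a) = (if x = b then 0 else Suc (x - a))"
    using True by (auto simp: Suc_diff_le)
  ultimately show ?thesis using True assms by (auto simp del: upt_Suc)
next
  case False
  thus ?thesis using assms by (auto simp: id_outside_supp simp del: upt_Suc)
qed

text \<open>The descending cycle (c, b, b-1, ..., a). The case c = 5, a = 7, b = n describes the
  factor of odd length that is needed for even n.\<close>

lemma cycle_of_list_Cons_rev_upt:
  assumes "c < a" "a \<le> b"
  shows "cycle_of_list (c # rev [a..<Suc b]) x
    = (if x = c then b else if x = a then c else if a < x \<and> x \<le> b then x - 1 else x)"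
proof (cases "x \<in> insert c {a..b}")
  case True
  define cs where "cs = c # rev [a..<Suc b]"
  have dist: "distinct cs" and len: "length cs = Suc (Suc b - a)"
    using assms by (auto simp: cs_def simp del: upt_Suc)
  have nth: "cs ! Suc (b - y) = y" if "a \<le> y" "y \<le> b" for y
    using that by (simp add: cs_def rev_nth del: upt_Suc)
  consider "x = c" | "x = a" | "a < x" "x \<le> b" using True by fastforce
  thus ?thesis
  proof cases
    case 1
    have "cycle_of_list cs (cs ! 0) = cs ! (Suc 0 mod length cs)"
      using dist len by (intro cycle_of_list_nth) auto
    moreover have "Suc 0 mod length cs = Suc (b - b)" using assms len by simp
    ultimately show ?thesis using 1 nth[of b] assms by (simp add: cs_def del: upt_Suc)
  next
    case 2
    have "cycle_of_list cs (cs ! Suc (b - a)) = cs ! (Suc (Suc (b - a)) mod length cs)"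
      using dist len assms by (intro cycle_of_list_nth) auto
    moreover have "Suc (Suc (b - a)) mod length cs = 0" using assms len by (simp add: Suc_diff_le)
    ultimately show ?thesis using 2 nth[of a] assms by (simp add: cs_def del: upt_Suc)
  next
    case 3
    have "cycle_of_list cs (cs ! Suc (b - x)) = cs ! (Suc (Suc (b - x)) mod length cs)"
      using dist len 3 by (intro cycle_of_list_nth) auto
    moreover have "Suc (Suc (b - x)) mod length cs = Suc (b - (x - 1))"
      using 3 assms len by (simp add: Suc_diff_le)
    ultimately show ?thesis using 3 nth[of x] nth[of "x - 1"] assms
      by (simp add: cs_def del: upt_Suc)
  qed
next
  case False
  thus ?thesis using assms by (auto simp: id_outside_supp simp del: upt_Suc)
qed

lemma alpha_permutes: "7 \<le> n \<Longrightarrow> alpha n permutes {3..n}"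
  unfolding alpha_def by (auto intro!: permutes_subset[OF cycle_permutes] simp del: upt_Suc cycle_of_list.simps)

lemma beta_permutes: "7 \<le> n \<Longrightarrow> beta n permutes {3..n}"
  unfolding beta_def by (auto intro!: permutes_subset[OF cycle_permutes] simp del: upt_Suc cycle_of_list.simps)

lemma evenperm_alpha: "7 \<le> n \<Longrightarrow> \<not> evenperm (alpha n)"
  by (simp add: alpha_def evenperm_cycle_of_list del: upt_Suc cycle_of_list.simps)

lemma evenperm_beta: "7 \<le> n \<Longrightarrow> evenperm (beta n)"
  by (simp add: beta_def evenperm_cycle_of_list del: upt_Suc cycle_of_list.simps)

lemma beta_even_apply:
  "even n \<Longrightarrow> beta n x = (if x = 3 then 7 else if x = 7 then 6 else if x = 6 then 4
      else if x = 4 then 5 else if x = 5 then 3 else x)"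
  by (simp add: beta_def transpose_def)

lemma beta_odd_apply:
  "odd n \<Longrightarrow> 7 \<le> n \<Longrightarrow> beta n x = (if 3 \<le> x \<and> x < n then x + 1 else if x = n then 3 else x)"
  using cycle_of_list_upt[of 3 n x] by (simp add: beta_def del: upt_Suc)

lemma alpha_even_apply:
  "even n \<Longrightarrow> 7 \<le> n \<Longrightarrow> alpha n x = (if 3 \<le> x \<and> x < n then x + 1 else if x = n then 3 else x)"
  using cycle_of_list_upt[of 3 n x] by (simp add: alpha_def del: upt_Suc)

lemma pinv_alpha_even_apply:
  assumes "even n" "7 \<le> n"
  shows "pinv (alpha n) x = (if 4 \<le> x \<and> x \<le> n then x - 1 else if x = 3 then n else x)"
  by (rule permutes_pinv_eqI[OF alpha_permutes]) (use assms in \<open>auto simp: alpha_even_apply\<close>)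

text \<open>Dividing the cycle (3,4,...,n) by the transposition (3,4) leaves the cycle
  (4,5,...,n).\<close>

lemma pinv_alpha_beta_odd:
  assumes "odd n" "7 \<le> n"
  shows "pinv (alpha n) \<circ> beta n = (\<lambda>x. if 4 \<le> x \<and> x < n then x + 1 else if x = n then 4 else x)"
proof -
  have "pinv (alpha n) = transpose 3 4" using assms by (simp add: alpha_def)
  thus ?thesis using assms by (auto simp: fun_eq_iff beta_odd_apply transpose_def)
qed

lemma pinv_alpha_beta_even:
  assumes "even n" "7 \<le> n"
  shows "pinv (alpha n) \<circ> beta n = transpose 3 6 \<circ> cycle_of_list (5 # rev [7..<Suc n])"
proof
  fix x :: nat
  have "8 \<le> n" using assms by presburger
  thus "(pinv (alpha n) \<circ> beta n) x = (transpose 3 6 \<circ> cycle_of_list (5 # rev [7..<Suc n])) x"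
    using assms by (auto simp: beta_even_apply pinv_alpha_even_apply cycle_of_list_Cons_rev_upt transpose_def
        simp del: upt_Suc cycle_of_list.simps)
qed

text \<open>The complements of T and of its image in U have equal size, so any bijection between
  them completes g.\<close>

lemma exists_permutes_extending:
  assumes "finite U" "T \<subseteq> U" "g ` T \<subseteq> U" "inj_on g T"
  obtains p where "p permutes U" "\<And>x. x \<in> T \<Longrightarrow> p x = g x"
proof -
  have "card (U - T) = card (U - g ` T)"
    using assms by (simp add: card_Diff_subset card_image finite_subset)
  then obtain k where k: "bij_betw k (U - T) (U - g ` T)"
    using assms(1) by (metis finite_Diff finite_same_card_bij)
  define p where "p x = (if x \<in> T then g x else if x \<in> U then k x else x)" for x
  have "bij_betw p T (g ` T)"
    using assms(4) by (auto simp: p_def bij_betw_def inj_on_def)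
  moreover have "bij_betw p (U - T) (U - g ` T)"
    using k by (rule bij_betw_cong[THEN iffD1, rotated]) (auto simp: p_def)
  ultimately have "bij_betw p (T \<union> (U - T)) (g ` T \<union> (U - g ` T))"
    by (rule bij_betw_combine) auto
  moreover have "T \<union> (U - T) = U" "g ` T \<union> (U - g ` T) = U" using assms by auto
  ultimately have "p permutes U"
    using assms(2) by (intro bij_imp_permutes) (auto simp: p_def)
  thus thesis by (rule that) (auto simp: p_def)
qed

subsection \<open>The centralizer of the idempotent\<close>

lemma permutes_3_n: "p permutes {3..n} \<Longrightarrow> p permutes {1..n::nat}"
  by (rule permutes_subset) auto

declare One_nat_def [simp del]

text \<open>An arbitrary monoid in which the four relations hold: \<open>h\<close> carries the
  permutations and \<open>e\<close> is the image of \<open>\<zeta>\<close>. Products are read from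
  left to right, hence the reversed composition in \<open>h_comp\<close>. Completeness of the
  presentation follows by applying the results to the quotient by any congruence that contains the
  relations.\<close>

locale transf_relations =
  fixes n :: nat and h :: "(nat \<Rightarrow> nat) \<Rightarrow> 'm::monoid_mult" and e :: 'm
  assumes n_ge: "7 \<le> n"
    and h_id: "h id = 1"
    and h_comp: "\<And>p q. p permutes {1..n} \<Longrightarrow> q permutes {1..n} \<Longrightarrow> h (q \<circ> p) = h p * h q"
    and rel1: "h (transpose 1 n \<circ> transpose 2 3) * e * h (transpose 1 n \<circ> transpose 2 3) * e
      = e * h (transpose 1 n \<circ> transpose 2 3) * e * h (transpose 1 n \<circ> transpose 2 3)"
    and rel2: "h (transpose 2 3) * e * h (transpose 2 3) * e * h (transpose 2 3) * e * h (transpose 2 3)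
      = e * h (transpose 2 3) * e"
    and rel3: "h (pinv (alpha n)) * e * h (alpha n)
      = e * h (transpose 1 3) * e * h (transpose 1 3)"
    and rel4: "h (pinv (beta n)) * e * h (beta n)
      = h (transpose 1 2) * e * h (transpose 1 3) * e * h (transpose 1 3)"
begin

text \<open>The inverse stands on the left because maps act on the right; in this way conjugation by
  p replaces every point i by \<open>p i\<close>.\<close>

definition conjugate :: "(nat \<Rightarrow> nat) \<Rightarrow> 'm \<Rightarrow> 'm" where
  "conjugate p x = h (pinv p) * x * h p"

lemma h_inv:
  assumes "p permutes {1..n}"
  shows "h p * h (pinv p) = 1" "h (pinv p) * h p = 1"
  using h_comp[OF assms permutes_inv[OF assms]] h_comp[OF permutes_inv[OF assms] assms]
    permutes_inv_o[OF assms] h_id by simp_all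

lemma h_inv_mult:
  assumes "p permutes {1..n}"
  shows "h p * (h (pinv p) * x) = x" "h (pinv p) * (h p * x) = x"
  using h_inv[OF assms] by (simp_all flip: mult.assoc)

lemma conj_id: "conjugate id x = x"
  by (simp add: conjugate_def h_id)

lemma conj_conj:
  assumes "p permutes {1..n}" "q permutes {1..n}"
  shows "conjugate q (conjugate p x) = conjugate (q \<circ> p) x"
  using assms by (simp add: conjugate_def h_comp permutes_inv pinv_comp[OF assms(2,1)] mult.assoc)

lemma conj_mult:
  assumes "p permutes {1..n}"
  shows "conjugate p (x * y) = conjugate p x * conjugate p y"
  using assms by (simp add: conjugate_def mult.assoc h_inv_mult)

lemma conj_h:
  assumes "p permutes {1..n}" "q permutes {1..n}"
  shows "conjugate p (h q) = h (p \<circ> q \<circ> pinv p)"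
  using assms by (simp add: conjugate_def h_comp permutes_inv permutes_compose mult.assoc)

lemma h_conj: "p permutes {1..n} \<Longrightarrow> h p * conjugate p x = x * h p"
  by (simp add: conjugate_def mult.assoc h_inv_mult)

lemma conj_pinv:
  assumes "p permutes {1..n}"
  shows "conjugate (pinv p) (conjugate p x) = x" "conjugate p (conjugate (pinv p) x) = x"
  using assms by (simp_all add: conj_conj permutes_inv permutes_inv_o conj_id)

lemma conj_inject: "p permutes {1..n} \<Longrightarrow> conjugate p x = conjugate p y \<longleftrightarrow> x = y"
  by (metis conj_pinv(1))

lemma transpose_permutes: "a \<in> {1..n} \<Longrightarrow> b \<in> {1..n} \<Longrightarrow> transpose a b permutes {1..n}"
  by (rule permutes_swap_id)

lemma transpose_permutes': "1 \<le> a \<Longrightarrow> a \<le> n \<Longrightarrow> 1 \<le> b \<Longrightarrow> b \<le> n \<Longrightarrow> transpose a b permutes {1..n}"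
  by (rule permutes_swap_id) auto

lemma conj_h_transpose:
  assumes "p permutes {1..n}" "a \<in> {1..n}" "b \<in> {1..n}"
  shows "conjugate p (h (transpose a b)) = h (transpose (p a) (p b))"
  by (simp add: conj_h[OF assms(1) transpose_permutes[OF assms(2,3)]] conj_transpose[OF assms(1)])

lemma h_transpose_square:
  assumes "a \<in> {1..n}" "b \<in> {1..n}"
  shows "h (transpose a b) * h (transpose a b) = 1" "h (transpose a b) * (h (transpose a b) * x) = x"
  using h_inv[OF transpose_permutes[OF assms]] h_inv_mult[OF transpose_permutes[OF assms]] by simp_all

abbreviation s where "s \<equiv> h (transpose 1 2)"
abbreviation t where "t \<equiv> h (transpose 2 3)"
abbreviation X where "X \<equiv> conjugate (transpose 1 3) e"
abbreviation Y where "Y \<equiv> conjugate (transpose 2 3) e"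

lemma s_s: "s * s = 1" "s * (s * x) = x"
  using h_transpose_square[of 1 2] n_ge by auto

lemma t_t: "t * t = 1" "t * (t * x) = x"
  using h_transpose_square[of 2 3] n_ge by auto

lemma permutes_alpha: "alpha n permutes {3..n}"
  using alpha_permutes n_ge .

lemma permutes_beta: "beta n permutes {3..n}"
  using beta_permutes n_ge .

lemma conj_alpha: "conjugate (alpha n) e = e * X"
  using rel3 by (simp add: conjugate_def mult.assoc)

lemma conj_beta: "conjugate (beta n) e = s * conjugate (alpha n) e"
  using rel4 by (simp add: conj_alpha) (simp add: conjugate_def mult.assoc)

lemma conj_s: "p permutes {3..n} \<Longrightarrow> conjugate p s = s"
  using conj_h_transpose[of p 1 2] n_ge permutes_not_in[of p "{3..n}" 1] permutes_not_in[of p "{3..n}" 2]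
  by (simp add: permutes_3_n)

text \<open>This is \<beta> followed by the inverse of \<alpha>. The right sides of the last two
  relations differ only by a factor \<open>s\<close>, so it conjugates e to
  \<open>s * e\<close>.\<close>

definition gam :: "nat \<Rightarrow> nat" where
  "gam = pinv (alpha n) \<circ> beta n"

lemma permutes_gam: "gam permutes {3..n}"
  unfolding gam_def by (intro permutes_compose permutes_inv permutes_alpha permutes_beta)

lemma conj_gam: "conjugate gam e = s * e"
proof -
  have "conjugate gam e = conjugate (pinv (alpha n)) (conjugate (beta n) e)"
    unfolding gam_def
    by (rule conj_conj[symmetric]) (intro permutes_3_n permutes_inv permutes_alpha permutes_beta)+
  also have "\<dots> = s * conjugate (pinv (alpha n)) (conjugate (alpha n) e)"
    by (simp add: conj_beta conj_mult conj_s permutes_3_n permutes_inv permutes_alpha)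
  also have "\<dots> = s * e" by (simp add: conj_pinv permutes_3_n permutes_alpha)
  finally show ?thesis .
qed

section \<open>The centralizer of e and its closure properties\<close>

definition cent :: "(nat \<Rightarrow> nat) \<Rightarrow> bool" where
  "cent p \<longleftrightarrow> p permutes {3..n} \<and> conjugate p e = e"

lemma cent_comp: "cent p \<Longrightarrow> cent q \<Longrightarrow> cent (p \<circ> q)"
  unfolding cent_def by (metis conj_conj permutes_3_n permutes_compose)

lemma cent_pinv: "cent p \<Longrightarrow> cent (pinv p)"
  unfolding cent_def by (metis conj_pinv(1) permutes_3_n permutes_inv)

lemma comp_transpose_13:
  assumes "p permutes {3..n}" "p 3 = 3"
  shows "p \<circ> transpose 1 3 = transpose 1 3 \<circ> p"
proof -
  have "transpose 1 3 = p \<circ> transpose 1 3 \<circ> pinv p"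
    using conj_transpose[OF assms(1), of 1 3] permutes_not_in[OF assms(1), of 1] assms(2) by simp
  thus ?thesis by (metis comp_assoc comp_id permutes_inv_o(2)[OF assms(1)])
qed

lemma conj_X:
  assumes "p permutes {3..n}" "p 3 = 3"
  shows "conjugate p X = conjugate (transpose 1 3) (conjugate p e)"
  using assms n_ge by (simp add: conj_conj transpose_permutes' permutes_3_n comp_transpose_13)

text \<open>As p fixes 3, it commutes with (1,3) and so fixes X as well as e. Hence it fixes
  \<open>e * X\<close>, the conjugate of e by \<alpha>, and can be pulled back along
  \<alpha>.\<close>

lemma cent_alpha:
  assumes "cent p" "p 3 = 3"
  shows "cent (pinv (alpha n) \<circ> p \<circ> alpha n)"
proof -
  have p: "p permutes {3..n}" "conjugate p e = e" using assms(1) by (auto simp: cent_def)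
  have "conjugate (pinv (alpha n) \<circ> p \<circ> alpha n) e = conjugate (pinv (alpha n)) (conjugate p (conjugate (alpha n) e))"
    by (simp add: conj_conj permutes_3_n permutes_compose permutes_inv permutes_alpha p comp_assoc)
  also have "conjugate p (conjugate (alpha n) e) = conjugate (alpha n) e"
    by (simp add: conj_alpha conj_mult permutes_3_n p conj_X assms(2))
  also have "conjugate (pinv (alpha n)) (conjugate (alpha n) e) = e"
    by (simp add: conj_pinv permutes_3_n permutes_alpha)
  finally show ?thesis
    unfolding cent_def by (intro conjI permutes_compose permutes_inv permutes_alpha p)
qed

lemma conj_pinv_gam: "conjugate (pinv gam) e = s * e"
proof -
  have "e = s * conjugate (pinv gam) e"
    using arg_cong[OF conj_gam, of "conjugate (pinv gam)"]
    by (simp add: conj_pinv conj_mult conj_s permutes_3_n permutes_inv permutes_gam)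
  thus ?thesis by (metis s_s(2))
qed

text \<open>Both \<open>gam\<close> and its inverse conjugate e to \<open>s * e\<close>, and p fixes
  \<open>s\<close>; the two factors \<open>s\<close> cancel.\<close>

lemma cent_gam:
  assumes "cent p"
  shows "cent (gam \<circ> p \<circ> pinv gam)"
proof -
  have p: "p permutes {3..n}" "conjugate p e = e" using assms(1) by (auto simp: cent_def)
  have "conjugate (gam \<circ> p \<circ> pinv gam) e = conjugate gam (conjugate p (conjugate (pinv gam) e))"
    by (simp add: conj_conj permutes_3_n permutes_compose permutes_inv permutes_gam p comp_assoc)
  also have "\<dots> = e"
    by (simp add: conj_pinv_gam conj_mult conj_s permutes_3_n p permutes_gam conj_gam s_s)
  finally show ?thesis by (simp add: cent_def permutes_compose permutes_inv permutes_gam p)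
qed

lemma conj_gam_funpow: "(gam ^^ k) permutes {3..n} \<and> conjugate (gam ^^ k) e = (if even k then e else s * e)"
proof (induction k)
  case (Suc k)
  hence perm: "(gam ^^ k) permutes {3..n}" by simp
  have "conjugate (gam ^^ Suc k) e = conjugate gam (conjugate (gam ^^ k) e)"
    by (simp add: conj_conj permutes_3_n perm permutes_gam)
  also have "\<dots> = (if even (Suc k) then e else s * e)"
    using Suc by (simp add: conj_gam conj_mult conj_s permutes_3_n permutes_gam s_s)
  finally show ?case using permutes_compose[OF perm permutes_gam] unfolding funpow.simps by blast
qed (simp only: funpow.simps conj_id permutes_id even_zero if_True simp_thms)

section \<open>Conjugation of e by transpositions\<close>

lemma transpose_permutes_3: "3 \<le> a \<Longrightarrow> a \<le> n \<Longrightarrow> 3 \<le> b \<Longrightarrow> b \<le> n \<Longrightarrow> transpose a b permutes {3..n}"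
  by (rule permutes_swap_id) auto

text \<open>Transpositions are involutions. Elements of the centralizer thereby become equations
  between conjugates of e, and conversely.\<close>

lemma cent_transposes_iff:
  assumes "a \<in> {3..n}" "b \<in> {3..n}" "c \<in> {3..n}" "d \<in> {3..n}"
  shows "cent (transpose a b \<circ> transpose c d) \<longleftrightarrow> conjugate (transpose a b) e = conjugate (transpose c d) e"
proof -
  have perm: "transpose a b permutes {3..n}" "transpose c d permutes {3..n}"
    using assms by (auto intro!: permutes_swap_id)
  have "conjugate (transpose a b \<circ> transpose c d) e = conjugate (transpose a b) (conjugate (transpose c d) e)"
    by (simp add: conj_conj perm permutes_3_n)
  moreover have "conjugate (transpose a b) (conjugate (transpose a b) e) = e"
    using conj_pinv(1)[OF permutes_3_n[OF perm(1)]] by simp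
  ultimately show ?thesis
    using perm conj_inject[OF permutes_3_n[OF perm(1)]] by (metis cent_def permutes_compose)
qed

text \<open>Each (3,k) exchanges e and f, and (a,b) is the product (3,a)(3,b)(3,a) of three of
  them.\<close>

lemma conj_transposes_if_star:
  assumes star: "\<And>k. k \<in> {4..n} \<Longrightarrow> conjugate (transpose 3 k) e = f"
    and ab: "a \<in> {3..n}" "b \<in> {3..n}" "a \<noteq> b"
  shows "conjugate (transpose a b) e = f"
proof -
  have tr: "transpose 3 k permutes {1..n}" if "k \<in> {4..n}" for k
    using that n_ge by (intro transpose_permutes') auto
  have star': "conjugate (transpose 3 k) f = e" if "k \<in> {4..n}" for k
    using conj_pinv(1)[OF tr[OF that], of e] star[OF that] by simp
  consider "a = 3" "b \<in> {4..n}" | "b = 3" "a \<in> {4..n}" | "a \<in> {4..n}" "b \<in> {4..n}"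
    using ab by fastforce
  thus ?thesis
  proof cases
    case 3
    have "transpose a b = transpose 3 a \<circ> transpose 3 b \<circ> transpose 3 a"
      using 3 ab(3) by (auto simp: fun_eq_iff transpose_def)
    hence "conjugate (transpose a b) e = conjugate (transpose 3 a) (conjugate (transpose 3 b) (conjugate (transpose 3 a) e))"
      using 3 by (simp add: conj_conj tr permutes_compose comp_assoc)
    thus ?thesis using 3 by (simp add: star star')
  qed (use star in \<open>auto simp: transpose_commute\<close>)
qed

text \<open>Conjugation by \<open>gam\<close>, a cycle on \<open>{4..n}\<close>, spreads one equation of transpositions to all pairs of
  equal parity, and a commutator of two 3-cycles connects the two parities.\<close>

lemma star_odd:
  assumes "odd n"
  shows "\<forall>k\<in>{4..n}. conjugate (transpose 3 k) e = conjugate (transpose 3 4) e"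
proof -
  have gam: "gam = (\<lambda>x. if 4 \<le> x \<and> x < n then x + 1 else if x = n then 4 else x)"
    unfolding gam_def using assms n_ge by (rule pinv_alpha_beta_odd)
  define F where "F k = conjugate (transpose 3 k) e" for k
  have cent_F: "cent (transpose 3 a \<circ> transpose 3 b) \<longleftrightarrow> F a = F b"
    if "a \<in> {4..n}" "b \<in> {4..n}" for a b
    unfolding F_def by (rule cent_transposes_iff) (use that n_ge in auto)
  \<comment> \<open>\<open>gam\<close> fixes 3, so conjugation by it moves only the other point of
    each transposition.\<close>
  have step: "F (gam a) = F (gam b)" if "F a = F b" "a \<in> {4..n}" "b \<in> {4..n}" for a b
  proof -
    have "cent (gam \<circ> (transpose 3 a \<circ> transpose 3 b) \<circ> pinv gam)"
      using that cent_F by (intro cent_gam) auto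
    also have "gam \<circ> (transpose 3 a \<circ> transpose 3 b) \<circ> pinv gam
        = (gam \<circ> transpose 3 a \<circ> pinv gam) \<circ> (gam \<circ> transpose 3 b \<circ> pinv gam)"
      using permutes_pinv_apply(2)[OF permutes_gam] by (simp add: fun_eq_iff)
    also have "\<dots> = transpose 3 (gam a) \<circ> transpose 3 (gam b)"
      using n_ge by (simp add: conj_transpose[OF permutes_gam]) (simp add: gam)
    finally show ?thesis using that n_ge by (subst (asm) cent_F) (auto simp: gam)
  qed
  \<comment> \<open>The square of \<open>gam\<close> centralizes e, because
    \<open>s * s = 1\<close>, and it fixes 3. So its conjugate by \<alpha> = (3,4) centralizes e
    too, and the quotient of the two is a product of (3,n-1) and (3,4): the first equation between
    two values of F.\<close>
  define \<theta> where "\<theta> = gam \<circ> gam"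
  have "cent (gam ^^ 2)" using conj_gam_funpow[of 2] by (simp add: cent_def)
  hence cent_\<theta>: "cent \<theta>" by (simp add: \<theta>_def numeral_2_eq_2)
  hence \<theta>_perm: "\<theta> permutes {3..n}" by (simp add: cent_def)
  have alpha: "alpha n = transpose 3 4" using assms by (simp add: alpha_def)
  have "\<theta> 3 = 3" using n_ge by (simp add: \<theta>_def gam)
  hence "cent (transpose 3 4 \<circ> \<theta> \<circ> transpose 3 4)"
    using cent_alpha[OF cent_\<theta>] by (simp add: alpha)
  hence "cent (pinv \<theta> \<circ> (transpose 3 4 \<circ> \<theta> \<circ> transpose 3 4))"
    by (rule cent_comp[OF cent_pinv[OF cent_\<theta>]])
  also have "pinv \<theta> \<circ> (transpose 3 4 \<circ> \<theta> \<circ> transpose 3 4)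
      = (pinv \<theta> \<circ> transpose 3 4 \<circ> \<theta>) \<circ> transpose 3 4" by (simp add: comp_assoc)
  also have "\<dots> = transpose 3 (n - 1) \<circ> transpose 3 4"
  proof -
    have "pinv \<theta> 3 = 3" by (rule permutes_pinv_eqI[OF \<theta>_perm]) fact
    moreover have "pinv \<theta> 4 = n - 1"
      by (rule permutes_pinv_eqI[OF \<theta>_perm]) (use n_ge in \<open>auto simp: \<theta>_def gam\<close>)
    ultimately show ?thesis by (simp add: conj_transpose_pinv[OF \<theta>_perm])
  qed
  finally have "F (n - 1) = F 4" using n_ge by (subst (asm) cent_F) auto
  \<comment> \<open>Shifting once leads to the points n and 5, shifting again wraps n around to 4.
    The result compares two points at distance 2.\<close>
  hence "F (gam (n - 1)) = F (gam 4)" by (rule step) (use n_ge in auto)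
  hence "F n = F 5" using n_ge by (simp add: gam split: if_splits)
  hence "F (gam n) = F (gam 5)" by (rule step) (use n_ge in auto)
  hence F46: "F 4 = F 6" using n_ge by (simp add: gam split: if_splits)
  have F_add2: "F (k + 2) = F k" if "4 \<le> k" "k + 2 \<le> n" for k
    using that
  proof (induction k rule: dec_induct)
    case base thus ?case using F46 by simp
  next
    case (step j)
    hence "F (gam (j + 2)) = F (gam j)" by (intro \<open>\<And>a b. F a = F b \<Longrightarrow> _ \<Longrightarrow> _ \<Longrightarrow> F (gam a) = F (gam b)\<close>) auto
    thus ?case using step by (simp add: gam One_nat_def)
  qed
  have F57: "F 7 = F 5" using F_add2[of 5] n_ge by simp
  \<comment> \<open>\<open>?p'\<close> and \<open>?q'\<close> are the inverses of the 3-cycles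
    \<open>?p\<close> and \<open>?q\<close>. These share only the point 3, so their commutator is
    again a 3-cycle through 3.\<close>
  have "F 7 = F 6"
  proof -
    let ?p = "transpose 3 4 \<circ> transpose (3::nat) 6" and ?q = "transpose 3 5 \<circ> transpose (3::nat) 7"
    let ?p' = "transpose 3 6 \<circ> transpose (3::nat) 4" and ?q' = "transpose 3 7 \<circ> transpose (3::nat) 5"
    have "cent ?p" "cent ?q" "cent ?p'" "cent ?q'"
      using F46 F57 n_ge by (simp_all add: cent_F)
    hence "cent (?p \<circ> ?q \<circ> ?p' \<circ> ?q')" using cent_comp by blast
    also have "?p \<circ> ?q \<circ> ?p' \<circ> ?q' = transpose 3 7 \<circ> transpose 3 6"
      by (auto simp: fun_eq_iff transpose_def)
    finally show ?thesis using n_ge by (subst (asm) cent_F) auto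
  qed
  hence F54: "F 5 = F 4" using F46 F57 by simp
  have "F k = F 4" if "4 \<le> k" "k \<le> n" for k
    using that
  proof (induction k rule: less_induct)
    case (less k)
    show ?case
    proof (cases "k < 6")
      case True
      hence "k = 4 \<or> k = 5" using less.prems by auto
      thus ?thesis using F54 by auto
    next
      case False
      hence "k = (k - 2) + 2" by simp
      then obtain j where k: "k = j + 2" by blast
      hence "F j = F 4" using less.IH[of j] less.prems False by auto
      thus ?thesis using F_add2[of j] less.prems False k by auto
    qed
  qed
  hence "\<forall>k\<in>{4..n}. F k = F 4" by (metis atLeastAtMost_iff)
  thus ?thesis unfolding F_def .
qed

text \<open>Here \<open>gam\<close> is the product of \<open>(3,6)\<close> and a disjoint cycle of odd length, so powers of \<open>gam\<close> separate
  the two factors.\<close>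

lemma star_even:
  assumes "even n"
  shows "\<forall>k\<in>{4..n}. conjugate (transpose 3 k) e = s * e"
proof -
  have n8: "8 \<le> n" using assms n_ge by presburger
  define \<kappa> where "\<kappa> = cycle_of_list (5 # rev [7..<Suc n])"
  have \<kappa>: "\<kappa> x = (if x = 5 then n else if x = 7 then 5 else if 7 < x \<and> x \<le> n then x - 1 else x)" for x
    unfolding \<kappa>_def by (rule cycle_of_list_Cons_rev_upt) (use n8 in auto)
  have gam: "gam = transpose 3 6 \<circ> \<kappa>"
    unfolding gam_def \<kappa>_def using assms n_ge by (rule pinv_alpha_beta_even)
  have comm: "transpose 3 6 \<circ> \<kappa> = \<kappa> \<circ> transpose 3 6"
    by (rule ext) (use n8 in \<open>auto simp: \<kappa> transpose_def\<close>)
  have len: "length (5 # rev [7..<Suc n]) = n - 5" using n8 by simp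
  have \<kappa>_funpow: "\<kappa> ^^ (n - 5) = id"
    using cycle_is_id_root[of "5 # rev [7..<Suc n]"] unfolding \<kappa>_def len by auto
  have "gam ^^ k = (if even k then id else transpose 3 6) \<circ> \<kappa> ^^ k" for k
  proof (induction k)
    case (Suc k)
    have "gam ^^ Suc k = (transpose 3 6 \<circ> \<kappa>) \<circ> ((if even k then id else transpose 3 6) \<circ> \<kappa> ^^ k)"
      using Suc unfolding funpow.simps gam by (simp only:)
    also have "\<dots> = (if even (Suc k) then id else transpose 3 6) \<circ> \<kappa> ^^ Suc k"
    proof (cases "even k")
      case False
      have "transpose 3 6 \<circ> \<kappa> \<circ> (transpose 3 6 \<circ> \<kappa> ^^ k) = \<kappa> \<circ> (transpose 3 6 \<circ> transpose 3 6) \<circ> \<kappa> ^^ k"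
        unfolding comm by (simp only: comp_assoc)
      thus ?thesis using False by simp
    qed (simp add: comp_assoc)
    finally show ?case .
  qed simp
  \<comment> \<open>The length n - 5 of \<kappa> is odd, so this power of \<open>gam\<close> leaves
    only (3,6) and sends e to \<open>s * e\<close>. The next exponent n - 4 is even and leaves only
    \<kappa>, which therefore centralizes e.\<close>
  moreover have "odd (n - 5)" "n - 4 = Suc (n - 5)" using assms n8 by auto
  ultimately have pow: "gam ^^ (n - 5) = transpose 3 6" "gam ^^ (n - 4) = \<kappa>"
    by (simp_all add: \<kappa>_funpow)
  define F where "F k = conjugate (transpose 3 k) e" for k
  have F6: "F 6 = s * e"
    using conj_gam_funpow[of "n - 5"] \<open>odd (n - 5)\<close> by (simp add: F_def pow)
  have cent_\<kappa>: "cent \<kappa>"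
    using conj_gam_funpow[of "n - 4"] assms n8 by (simp add: cent_def pow)
  \<comment> \<open>\<kappa> fixes 3, so its conjugate by \<alpha> centralizes e. This conjugate
    fixes 3 as well, since \<kappa> fixes 4, the image of 3 under \<alpha>.\<close>
  define \<kappa>' where "\<kappa>' = pinv (alpha n) \<circ> \<kappa> \<circ> alpha n"
  have cent_\<kappa>': "cent \<kappa>'"
    unfolding \<kappa>'_def by (rule cent_alpha[OF cent_\<kappa>]) (simp add: \<kappa>)
  \<comment> \<open>A centralizing permutation that fixes 3 transports the value of F along its
    orbits.\<close>
  have F_move: "F (p k) = s * e" if "F k = s * e" "cent p" "p 3 = 3" "k \<in> {4..n}" for p k
  proof -
    have p: "p permutes {3..n}" "conjugate p e = e" using that(2) by (auto simp: cent_def)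
    have "F (p k) = conjugate (p \<circ> transpose 3 k \<circ> pinv p) e"
      by (simp add: conj_transpose[OF p(1)] F_def that(3))
    also have "\<dots> = conjugate p (conjugate (transpose 3 k) (conjugate (pinv p) e))"
      using that(4) n_ge
      by (simp add: conj_conj permutes_3_n permutes_compose permutes_inv p transpose_permutes_3 comp_assoc)
    also have "\<dots> = s * e"
      using cent_pinv[OF that(2)] that(1) p by (simp add: cent_def F_def conj_mult conj_s permutes_3_n)
    finally show ?thesis .
  qed
  have \<kappa>'_apply: "\<kappa>' 3 = 3" "\<kappa>' 6 = 4" "\<kappa>' 4 = n - 1" "\<And>k. 8 \<le> k \<Longrightarrow> k < n \<Longrightarrow> \<kappa>' k = k - 1"
    using assms n8 by (auto simp: \<kappa>'_def alpha_even_apply pinv_alpha_even_apply \<kappa>)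
  \<comment> \<open>The value at 6 travels along \<kappa>' through 4, n - 1, n - 2 and so on down to
    7, then along \<kappa> from 7 to 5 and to n. All points of {4..n} are reached.\<close>
  have F4: "F 4 = s * e" using F_move[OF F6 cent_\<kappa>'] \<kappa>'_apply n8 by simp
  have Fn1: "F (n - 1) = s * e" using F_move[OF F4 cent_\<kappa>'] \<kappa>'_apply n8 by simp
  have F_mid: "F k = s * e" if "7 \<le> k" "k \<le> n - 1" for k
    using that(2,1)
  proof (induction k rule: inc_induct)
    case (step k)
    thus ?case using F_move[OF _ cent_\<kappa>', of "Suc k"] \<kappa>'_apply n8 by simp
  qed (use Fn1 in simp)
  have F5: "F 5 = s * e" using F_move[OF F_mid[of 7] cent_\<kappa>] n8 by (simp add: \<kappa>)
  have Fn: "F n = s * e" using F_move[OF F5 cent_\<kappa>] n8 by (simp add: \<kappa>)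
  have "F k = s * e" if "k \<in> {4..n}" for k
  proof -
    consider "k = 4" | "k = 5" | "k = 6" | "k = n" | "7 \<le> k" "k \<le> n - 1" using \<open>k \<in> {4..n}\<close> by fastforce
    thus ?thesis using F4 F5 F6 Fn F_mid by cases auto
  qed
  thus ?thesis by (simp add: F_def)
qed

text \<open>All transpositions of {3..n} exchange e with one and the same f, so only the parity of p
  matters. As \<alpha> is odd and \<beta> even, \<open>conj_beta\<close> becomes
  \<open>e = s * f\<close>.\<close>

lemma conj_parity:
  assumes "p permutes {3..n}"
  shows "conjugate p e = (if evenperm p then e else s * e)"
proof -
  obtain f where f: "\<And>a b. a \<in> {3..n} \<Longrightarrow> b \<in> {3..n} \<Longrightarrow> a \<noteq> b \<Longrightarrow> conjugate (transpose a b) e = f"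
    using conj_transposes_if_star star_even star_odd by metis
  have parity: "conjugate p e = (if evenperm p then e else f)" if "p permutes {3..n}" for p
    using that finite_atLeastAtMost
  proof (induction p rule: permutes_induct)
    case id show ?case using conj_id evenperm_id by (metis id_apply)
  next
    case (swap a b p)
    have tr: "transpose a b permutes {1..n}" using swap by (intro permutes_3_n permutes_swap_id)
    have "conjugate (transpose a b) f = e"
      using conj_pinv(1)[OF tr, of e] f[OF swap(1-3)] by simp
    moreover have "conjugate (transpose a b \<circ> p) e = conjugate (transpose a b) (conjugate p e)"
      by (rule conj_conj[OF permutes_3_n[OF swap(4)] tr, symmetric])
    moreover have "evenperm (transpose a b \<circ> p) \<longleftrightarrow> \<not> evenperm p"
      using swap evenperm_comp[OF permutation_swap_id permutes_imp_permutation[OF _ swap(4)], of a b]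
      by (simp add: evenperm_swap)
    ultimately show ?case using swap(5) f[OF swap(1-3)] by (cases "evenperm p") (simp_all add: o_def)
  qed
  have "e = s * f"
    using parity[OF permutes_beta] parity[OF permutes_alpha] conj_beta n_ge
    by (simp add: evenperm_alpha evenperm_beta)
  hence "f = s * e" by (metis s_s(2))
  thus ?thesis using parity[OF assms] by simp
qed

subsection \<open>Idempotents of rank \<open>n - 1\<close> and normal forms\<close>

lemma e_X: "e * X = s * e"
  using conj_alpha conj_parity[OF permutes_alpha] evenperm_alpha n_ge by simp

text \<open>The transposition (4,5) is odd and fixes 1, 2 and 3, so conjugating by it turns e into
  \<open>s * e\<close> and X into \<open>t * X\<close>. Applied to \<open>e * X = s * e\<close> it
  gives \<open>e * (t * X) = s * e\<close>, while conjugation by (1,3) gives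
  \<open>X * e = t * X\<close>. Evaluating e X e in both ways makes e idempotent. Conjugating
  \<open>e * e = e\<close> by (4,5) gives e s e = e, and e s e = e e X = s e.\<close>

lemma s_e_and_idem: "s * e = e" "e * e = e"
proof -
  let ?p = "transpose (4::nat) 5" and ?u = "transpose (1::nat) 3"
  have p: "?p permutes {3..n}" and u: "?u permutes {1..n}"
    using n_ge by (auto intro!: permutes_swap_id)
  have conj_p: "conjugate ?p e = s * e"
    using conj_parity[OF p] by (simp add: evenperm_swap)
  have conj_u_s: "conjugate ?u s = t"
    using conj_h_transpose[OF u, of 1 2] n_ge by (simp add: transpose_commute)
  have conj_p_X: "conjugate ?p X = t * X"
    using conj_X[OF p] by (simp add: conj_p conj_mult[OF u] conj_u_s)
  have "conjugate ?p (e * X) = conjugate ?p (s * e)" by (simp add: e_X)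
  hence "s * (e * (t * X)) = e"
    by (simp add: conj_mult permutes_3_n p conj_p conj_p_X conj_s s_s mult.assoc)
  hence e_t_X: "e * (t * X) = s * e" by (metis s_s(2))
  have "conjugate ?u (e * X) = conjugate ?u (s * e)" by (simp add: e_X)
  moreover have "conjugate ?u X = e" using conj_pinv(1)[OF u, of e] by simp
  ultimately have X_e: "X * e = t * X" by (simp add: conj_mult[OF u] conj_u_s)
  have "s * (e * e) = e * (X * e)" by (simp add: e_X flip: mult.assoc)
  also have "\<dots> = s * e" by (simp add: X_e e_t_X)
  finally show idem: "e * e = e" by (metis s_s(2))
  have "conjugate ?p (e * e) = conjugate ?p e" by (simp add: idem)
  hence "s * (e * (s * e)) = s * e" by (simp add: conj_mult permutes_3_n p conj_p mult.assoc)
  hence "e * (s * e) = e" by (metis s_s(2))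
  moreover have "e * (s * e) = s * e"
    by (simp add: idem flip: e_X) (simp add: idem flip: mult.assoc)
  ultimately show "s * e = e" by simp
qed

section \<open>Idempotents with arbitrary labels and their laws\<close>

lemma conj_e_stab: "p permutes {3..n} \<Longrightarrow> conjugate p e = e"
  by (simp add: conj_parity s_e_and_idem)

text \<open>The abstract counterpart of the idempotent that maps j to i. Two choices of p differ by
  a permutation of {3..n}, which fixes e, so the choice does not matter
  (\<open>conj_e\<close>).\<close>

definition el :: "nat \<Rightarrow> nat \<Rightarrow> 'm" where
  "el i j = conjugate (SOME p. p permutes {1..n} \<and> p 1 = i \<and> p 2 = j) e"

lemma conj_e:
  assumes p: "p permutes {1..n}"
  shows "conjugate p e = el (p 1) (p 2)"
proof -
  define q where "q = (SOME q. q permutes {1..n} \<and> q 1 = p 1 \<and> q 2 = p 2)"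
  have "q permutes {1..n} \<and> q 1 = p 1 \<and> q 2 = p 2"
    unfolding q_def by (rule someI[of _ p]) (use p in simp)
  hence q: "q permutes {1..n}" "q 1 = p 1" "q 2 = p 2" by blast+
  have qp: "pinv q \<circ> p permutes {1..n}" by (intro permutes_compose permutes_inv p q)
  have "(pinv q \<circ> p) x = x" if "x \<in> {1..n} - {3..n}" for x
  proof -
    have "x = 1 \<or> x = 2" using that by auto
    thus ?thesis using q(2,3) permutes_pinv_apply(2)[OF q(1)] by (metis comp_apply)
  qed
  hence "pinv q \<circ> p permutes {3..n}" by (metis permutes_superset[OF qp])
  hence "conjugate (pinv q \<circ> p) e = e" by (rule conj_e_stab)
  moreover have "q \<circ> (pinv q \<circ> p) = p" by (simp add: fun_eq_iff permutes_pinv_apply[OF q(1)])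
  ultimately have "conjugate p e = conjugate q e" using conj_conj[OF qp q(1), of e] by simp
  thus ?thesis by (simp add: el_def q_def)
qed

text \<open>The relations yield laws at the points 1, 2, 3, n only; conjugation by such a p spreads
  them to any distinct labels.\<close>

lemma exists_perm4:
  assumes "distinct [i, j, k, l]" "{i, j, k, l} \<subseteq> {1..n}"
  obtains p where "p permutes {1..n}" "p 1 = i" "p 2 = j" "p 3 = k" "p n = l"
proof -
  let ?g = "\<lambda>x. if x = 1 then i else if x = 2 then j else if x = 3 then k else l"
  obtain p where "p permutes {1..n}" "\<And>x. x \<in> {1, 2, 3, n} \<Longrightarrow> p x = ?g x"
    using exists_permutes_extending[of "{1..n}" "{1, 2, 3, n}" ?g] assms n_ge
    by (auto simp: inj_on_def)
  thus thesis using that[of p] n_ge by auto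
qed

lemma exists_fourth:
  assumes "i \<in> {1..n}" "j \<in> {1..n}" "k \<in> {1..n}"
  obtains l where "l \<in> {1..n}" "l \<notin> {i, j, k}"
proof -
  have "card {i, j, k} < card {1..n}"
    using n_ge card_length[of "[i, j, k]"] by simp
  hence "\<not> {1..n} \<subseteq> {i, j, k}" using card_mono[of "{i, j, k}" "{1..n}"] by auto
  then obtain l where "l \<in> {1..n}" "l \<notin> {i, j, k}" by blast
  thus thesis by (rule that)
qed

lemma exists_perm3:
  assumes "distinct [i, j, k]" "{i, j, k} \<subseteq> {1..n}"
  obtains p where "p permutes {1..n}" "p 1 = i" "p 2 = j" "p 3 = k"
proof -
  obtain l where "l \<in> {1..n}" "l \<notin> {i, j, k}" using exists_fourth[of i j k] assms(2) by auto
  thus thesis using exists_perm4[of i j k l] assms that by auto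
qed

lemma exists_perm2:
  assumes "i \<noteq> j" "{i, j} \<subseteq> {1..n}"
  obtains p where "p permutes {1..n}" "p 1 = i" "p 2 = j"
proof -
  obtain l where "l \<in> {1..n}" "l \<notin> {i, j}" using exists_fourth[of i j j] assms(2) by auto
  thus thesis using exists_perm3[of i j l] assms that by auto
qed

lemma el_1_2: "el 1 2 = e"
  using conj_e[OF permutes_id] by (metis conj_id id_apply)

lemma conj_el:
  assumes "p permutes {1..n}" "i \<noteq> j" "{i, j} \<subseteq> {1..n}"
  shows "conjugate p (el i j) = el (p i) (p j)"
proof -
  obtain q where q: "q permutes {1..n}" "q 1 = i" "q 2 = j" using exists_perm2 assms(2,3) .
  hence "conjugate p (el i j) = conjugate (p \<circ> q) e"
    using conj_conj[OF q(1) assms(1), of e] conj_e[OF q(1)] by simp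
  also have "\<dots> = el ((p \<circ> q) 1) ((p \<circ> q) 2)"
    by (rule conj_e) (intro permutes_compose assms(1) q(1))
  finally show ?thesis using q by simp
qed

lemma X_eq: "X = el 3 2"
  using conj_e[OF transpose_permutes'[of 1 3]] n_ge by simp

lemma Y_eq: "Y = el 1 3"
  using conj_e[OF transpose_permutes'[of 2 3]] n_ge by simp

lemma h_el_absorb:
  assumes "i \<noteq> j" "{i, j} \<subseteq> {1..n}"
  shows "h (transpose i j) * el i j = el i j"
proof -
  obtain p where p: "p permutes {1..n}" "p 1 = i" "p 2 = j" using exists_perm2 assms .
  have "conjugate p (s * e) = conjugate p e" by (simp add: s_e_and_idem)
  thus ?thesis using p conj_h_transpose[OF p(1), of 1 2] n_ge by (simp add: conj_mult conj_e)
qed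

lemma el_swap:
  assumes "i \<noteq> j" "{i, j} \<subseteq> {1..n}"
  shows "el i j * h (transpose i j) = el j i"
proof -
  have tr: "transpose i j permutes {1..n}" using assms by (intro transpose_permutes) auto
  have "el j i = conjugate (transpose i j) (el i j)" using assms by (subst conj_el[OF tr]) auto
  also have "\<dots> = h (transpose i j) * el i j * h (transpose i j)" by (simp add: conjugate_def)
  finally show ?thesis using assms by (simp add: h_el_absorb)
qed

text \<open>For i = k this is idempotency of e, otherwise a conjugate of
  \<open>e * X = e\<close>.\<close>

lemma el_absorb:
  assumes "i \<noteq> j" "k \<noteq> j" "{i, j, k} \<subseteq> {1..n}"
  shows "el i j * el k j = el i j"
proof (cases "i = k")
  case True
  obtain p where p: "p permutes {1..n}" "p 1 = i" "p 2 = j" using exists_perm2 assms by blast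
  have "conjugate p (e * e) = conjugate p e" by (simp add: s_e_and_idem)
  thus ?thesis using p True by (simp add: conj_mult conj_e)
next
  case False
  obtain p where p: "p permutes {1..n}" "p 1 = i" "p 2 = j" "p 3 = k"
    using exists_perm3[of i j k] assms False by auto
  have "conjugate p (e * el 3 2) = conjugate p e" using e_X by (simp add: s_e_and_idem X_eq)
  thus ?thesis using p n_ge by (simp add: conj_mult conj_e conj_el)
qed

text \<open>Turning \<open>el j k\<close> around by \<open>el_swap\<close> gives
  \<open>el k j\<close>, which \<open>el_absorb\<close> removes.\<close>

lemma el_shift:
  assumes "i \<noteq> j" "k \<noteq> j" "{i, j, k} \<subseteq> {1..n}"
  shows "el i j * el j k = el i j * h (transpose j k)"
proof -
  have "el j k = el k j * h (transpose j k)"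
    using el_swap[of k j] assms by (simp add: transpose_commute)
  thus ?thesis using el_absorb assms by (simp flip: mult.assoc)
qed

text \<open>The first relation says that e commutes with its conjugate by the involution (1,n)(2,3),
  which is \<open>el n 3\<close>.\<close>

lemma el_commute_disjoint:
  assumes "distinct [i, j, k, l]" "{i, j, k, l} \<subseteq> {1..n}"
  shows "el i j * el k l = el k l * el i j"
proof -
  let ?\<tau> = "transpose 1 n \<circ> transpose 2 3"
  have \<tau>: "?\<tau> permutes {1..n}"
    using n_ge by (intro permutes_compose transpose_permutes') auto
  have "pinv ?\<tau> = ?\<tau>"
    using n_ge by (intro inv_unique_comp) (auto simp: fun_eq_iff transpose_def)
  hence "conjugate ?\<tau> e * e = e * conjugate ?\<tau> e" using rel1 by (simp add: conjugate_def mult.assoc)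
  moreover have "conjugate ?\<tau> e = el n 3" using conj_e[OF \<tau>] n_ge by simp
  ultimately have base: "el n 3 * e = e * el n 3" by simp
  obtain p where p: "p permutes {1..n}" "p 1 = i" "p 2 = j" "p 3 = l" "p n = k"
    using exists_perm4[of i j l k] assms by auto
  have "conjugate p (el n 3 * e) = conjugate p (e * el n 3)" by (simp add: base)
  thus ?thesis using p n_ge by (simp add: conj_mult conj_e conj_el)
qed

text \<open>Put m = e t e. Then e Y = m t and Y e = t m, and the second relation reads Y e Y = m,
  whose conjugate by (2,3) is e Y e = t m t. Writing m as e (Y e Y) = (e Y e) Y yields m = t m t, so
  t commutes with m; this is the first claim, and m = e Y then gives the second.\<close>

lemma e_Y: "e * Y = Y * e" "t * (e * Y) = e * Y"
proof -
  have t: "transpose 2 3 permutes {1..n}" using n_ge by (intro transpose_permutes') auto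
  have Y: "Y = t * e * t" by (simp add: conjugate_def)
  have YY: "Y * Y = Y" using conj_mult[OF t, of e e] by (simp add: s_e_and_idem)
  have tY: "t * Y = e * t"
    by (simp add: Y mult.assoc t_t)
  define m where "m = e * t * e"
  have m1: "Y * e * Y = m" using rel2 by (simp add: m_def Y mult.assoc)
  have em: "e * m = m" by (simp add: m_def s_e_and_idem flip: mult.assoc)
  have Ye: "Y * e = t * m" by (simp add: m_def Y mult.assoc)
  have eY: "e * Y = m * t" by (simp add: m_def Y mult.assoc)
  have "conjugate (transpose 2 3) (Y * e * Y) = t * m * t"
    by (simp add: m1) (simp add: conjugate_def)
  moreover have "conjugate (transpose 2 3) Y = e"
    using conj_pinv(1)[OF t, of e] by simp
  ultimately have eYe: "e * Y * e = t * m * t" by (simp add: conj_mult[OF t])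
  have "m = e * (Y * e * Y)" by (simp add: m1 em)
  also have "\<dots> = (e * Y * e) * Y" by (simp only: mult.assoc)
  also have "\<dots> = t * m * (t * Y)" unfolding eYe by (simp only: mult.assoc)
  also have "\<dots> = Y * (e * e) * t" unfolding tY Ye[symmetric] by (simp only: mult.assoc)
  also have "\<dots> = t * m * t" by (simp only: s_e_and_idem Ye)
  finally have "m * t = t * m * t * t" by simp
  hence "m * t = t * m" by (simp only: mult.assoc t_t mult_1_right)
  thus 1: "e * Y = Y * e" by (simp add: Ye eY)
  have "m = e * Y * Y" by (simp add: 1 m1)
  hence "m = e * Y" by (simp add: YY mult.assoc)
  moreover have "t * m = e * Y" by (simp add: 1 Ye)
  ultimately show "t * (e * Y) = e * Y" by simp
qed

lemma el_commute_common:
  assumes "distinct [i, j, k]" "{i, j, k} \<subseteq> {1..n}"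
  shows "el i j * el i k = el i k * el i j"
proof -
  obtain p where p: "p permutes {1..n}" "p 1 = i" "p 2 = j" "p 3 = k" using exists_perm3 assms .
  have "conjugate p (e * el 1 3) = conjugate p (el 1 3 * e)" using e_Y by (simp add: Y_eq)
  thus ?thesis using p n_ge by (simp add: conj_mult conj_e conj_el)
qed

lemma el_commute:
  assumes "{i, k} \<inter> {j, l} = {}" "j \<noteq> l" "{i, j, k, l} \<subseteq> {1..n}"
  shows "el i j * el k l = el k l * el i j"
proof (cases "i = k")
  case True
  have "el i j * el i l = el i l * el i j"
    by (rule el_commute_common) (use assms in auto)
  thus ?thesis using True by simp
next
  case False thus ?thesis using assms by (intro el_commute_disjoint) auto
qed

text \<open>Sending m to l and then l to k sends both to k. To derive it, e is written as
  \<open>el 2 1 * s\<close>, the two commuting idempotents with common target 2 are exchanged, and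
  \<open>s\<close> is moved to the left, where e absorbs it.\<close>

lemma el_merge:
  assumes "distinct [k, l, m]" "{k, l, m} \<subseteq> {1..n}"
  shows "el l m * el k l = el k l * el k m"
proof -
  have s: "transpose 1 2 permutes {1..n}" using n_ge by (intro transpose_permutes') auto
  have e: "e = el 2 1 * s" using el_swap[of 2 1] n_ge by (simp add: el_1_2 transpose_commute)
  have "el 2 3 * e = el 2 3 * (el 2 1 * s)" using e by (rule arg_cong)
  hence "el 2 3 * e = (el 2 3 * el 2 1) * s" by (simp only: mult.assoc)
  also have "el 2 3 * el 2 1 = el 2 1 * el 2 3" using n_ge by (intro el_commute_common) auto
  also have "\<dots> = conjugate (transpose 1 2) (e * el 1 3)"
    using conj_el[OF s, of 1 2] conj_el[OF s, of 1 3] n_ge by (simp add: conj_mult[OF s] el_1_2)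
  also have "\<dots> * s = s * (e * el 1 3)" by (simp add: conjugate_def mult.assoc s_s)
  also have "\<dots> = e * el 1 3" by (simp add: s_e_and_idem flip: mult.assoc)
  finally have base: "el 2 3 * e = e * el 1 3" .
  obtain p where p: "p permutes {1..n}" "p 1 = k" "p 2 = l" "p 3 = m" using exists_perm3 assms .
  have "conjugate p (el 2 3 * e) = conjugate p (e * el 1 3)" by (simp add: base)
  thus ?thesis using p n_ge by (simp add: conj_mult conj_e conj_el)
qed

section \<open>Commuting products of idempotents\<close>

definition el_prod :: "(nat \<Rightarrow> nat) \<Rightarrow> nat set \<Rightarrow> 'm" where
  "el_prod r S = Finite_Set.fold (\<lambda>x m. el (r x) x * m) 1 S"

text \<open>No target lies in S, which is what \<open>el_commute\<close> asks for; hence the order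
  of the factors in \<open>el_prod\<close> is immaterial and the fold over a set is
  meaningful.\<close>

definition admissible :: "(nat \<Rightarrow> nat) \<Rightarrow> nat set \<Rightarrow> bool" where
  "admissible r S \<longleftrightarrow> S \<subseteq> {1..n} \<and> r ` S \<subseteq> {1..n} - S"

lemma admissible_mono: "admissible r S \<Longrightarrow> S' \<subseteq> S \<Longrightarrow> admissible r S'"
  by (auto simp: admissible_def)

lemma admissible_finite: "admissible r S \<Longrightarrow> finite S"
  unfolding admissible_def using finite_subset by blast

lemma el_prod_empty: "el_prod r {} = 1"
  by (simp add: el_prod_def)

lemma el_prod_insert:
  assumes "admissible r (insert x S)" "x \<notin> S"
  shows "el_prod r (insert x S) = el (r x) x * el_prod r S"
proof -
  have comm: "el (r x) x * el (r y) y = el (r y) y * el (r x) x"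
    if "x \<in> insert x' S" "y \<in> insert x' S" "admissible r (insert x' S)" for x y x'
  proof (cases "x = y")
    case False
    thus ?thesis using that unfolding admissible_def by (intro el_commute) auto
  qed simp
  interpret comp_fun_commute_on "insert x S" "\<lambda>x m. el (r x) x * m"
    by standard (use comm[OF _ _ assms(1)] in \<open>auto simp: fun_eq_iff simp flip: mult.assoc\<close>)
  show ?thesis
    unfolding el_prod_def using assms(2) admissible_finite[OF assms(1)] by (intro fold_insert) auto
qed

lemma el_prod_commute:
  assumes "admissible r S" "\<And>x. x \<in> S \<Longrightarrow> c * el (r x) x = el (r x) x * c"
  shows "c * el_prod r S = el_prod r S * c"
  using admissible_finite[OF assms(1)] assms
proof (induction S rule: finite_induct)
  case (insert x S)
  have "c * el_prod r (insert x S) = (c * el (r x) x) * el_prod r S"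
    using el_prod_insert[OF insert.prems(1) insert.hyps(2)] by (simp only: mult.assoc)
  also have "c * el (r x) x = el (r x) x * c" by (rule insert.prems) simp
  also have "\<dots> * el_prod r S = el (r x) x * (c * el_prod r S)" by (rule mult.assoc)
  also have "c * el_prod r S = el_prod r S * c"
    using insert by (intro insert.IH) (auto intro: admissible_mono)
  finally show ?case using insert by (simp add: el_prod_insert mult.assoc)
qed (simp add: el_prod_empty)

text \<open>As the factors commute, any of them can be brought to the right end, where it meets the
  next letter.\<close>

lemma el_prod_last:
  assumes "admissible r S" "x \<in> S"
  obtains M where "el_prod r S = M * el (r x) x"
proof -
  have adm: "admissible r (S - {x})" using assms(1) by (rule admissible_mono) auto
  have "el_prod r S = el (r x) x * el_prod r (S - {x})"
    using el_prod_insert[of r x "S - {x}"] assms by (simp add: insert_absorb)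
  also have "\<dots> = el_prod r (S - {x}) * el (r x) x"
    by (rule el_prod_commute[OF adm]) (use assms in \<open>auto simp: admissible_def intro!: el_commute\<close>)
  finally show thesis by (rule that)
qed

text \<open>Choosing the least element of every kernel class makes a retraction unique for its kernel.\<close>

definition retraction :: "(nat \<Rightarrow> nat) \<Rightarrow> bool" where
  "retraction r \<longleftrightarrow> (\<forall>x. r (r x) = r x) \<and> (\<forall>x. r x \<le> x) \<and> (\<forall>x\<in>{1..n}. 1 \<le> r x)
     \<and> (\<forall>x. x \<notin> {1..n} \<longrightarrow> r x = x)"

definition moved :: "(nat \<Rightarrow> nat) \<Rightarrow> nat set" where
  "moved r = {x. r x \<noteq> x}"

definition ret_prod :: "(nat \<Rightarrow> nat) \<Rightarrow> 'm" where
  "ret_prod r = el_prod r (moved r)"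

lemma retraction_admissible:
  assumes "retraction r"
  shows "admissible r (moved r)"
proof -
  have "r x \<in> {1..n} - moved r" if "x \<in> moved r" for x
  proof -
    have "x \<in> {1..n}" using assms that by (auto simp: retraction_def moved_def)
    moreover have "r x \<le> x" "1 \<le> r x" using assms calculation by (auto simp: retraction_def)
    ultimately have "r x \<in> {1..n}" by simp
    thus ?thesis using assms by (simp add: retraction_def moved_def)
  qed
  moreover have "moved r \<subseteq> {1..n}" using assms by (auto simp: retraction_def moved_def)
  ultimately show ?thesis by (auto simp: admissible_def)
qed

lemma ret_prod_absorb:
  assumes "retraction r" "x \<in> moved r" "k \<in> {1..n}" "k \<noteq> x"
  shows "ret_prod r * el k x = ret_prod r"
proof -
  note adm = retraction_admissible[OF assms(1)]
  obtain M where M: "el_prod r (moved r) = M * el (r x) x"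
    using el_prod_last[OF adm assms(2)] .
  have "el (r x) x * el k x = el (r x) x"
    using adm assms by (intro el_absorb) (auto simp: admissible_def)
  thus ?thesis by (simp add: ret_prod_def M mult.assoc)
qed

lemma ret_prod_shift:
  assumes "retraction r" "x \<in> moved r" "k \<in> {1..n}" "k \<noteq> x"
  shows "ret_prod r * el x k = ret_prod r * h (transpose x k)"
proof -
  note adm = retraction_admissible[OF assms(1)]
  obtain M where M: "el_prod r (moved r) = M * el (r x) x"
    using el_prod_last[OF adm assms(2)] .
  have "el (r x) x * el x k = el (r x) x * h (transpose x k)"
    using adm assms by (intro el_shift) (auto simp: admissible_def)
  thus ?thesis by (simp add: ret_prod_def M mult.assoc)
qed

text \<open>For moved points a and b, \<open>ret_prod_shift\<close> trades (a,b) for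
  \<open>el a b\<close>, which \<open>ret_prod_absorb\<close> removes. This accounts for the freedom
  in the permutation of a normal form: it is arbitrary on points outside the image of r.\<close>

lemma ret_prod_h:
  assumes "retraction r" "p permutes moved r"
  shows "ret_prod r * h p = ret_prod r"
proof -
  have sub: "moved r \<subseteq> {1..n}"
    using retraction_admissible[OF assms(1)] by (simp add: admissible_def)
  show ?thesis
    using assms(2) admissible_finite[OF retraction_admissible[OF assms(1)]]
  proof (induction p rule: permutes_induct)
    case id show ?case using h_id by (simp add: id_def)
  next
    case (swap a b p)
    have "h (transpose a b \<circ> p) = h p * h (transpose a b)"
      using swap sub by (intro h_comp) (auto intro: permutes_subset transpose_permutes)
    hence "ret_prod r * h (transpose a b \<circ> p) = ret_prod r * h (transpose a b)"
      using swap by (simp flip: mult.assoc)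
    also have "\<dots> = ret_prod r"
      using ret_prod_shift[OF assms(1) swap(1), of b] ret_prod_absorb[OF assms(1) swap(2), of a] swap(1-3) sub
      by (metis subsetD)
    finally show ?case by (simp add: o_def)
  qed
qed

text \<open>The factor \<open>el k l\<close> is pulled to the left through the product:
  \<open>el_merge\<close> redirects the factors with target l to k, and all others commute with it.
  As k < l, the merged class is still represented by its least element.\<close>

lemma ret_prod_merge:
  assumes r: "retraction r" and kl: "k \<in> {1..n}" "l \<in> {1..n}" "r k = k" "r l = l" "k < l"
  defines "r' \<equiv> (\<lambda>x. if r x = l then k else r x)"
  shows "retraction r'" "ret_prod r * el k l = ret_prod r'"
proof -
  have le: "r x \<le> x" for x using r by (simp add: retraction_def)
  have le': "r' x \<le> x" for x using le[of x] kl(5) by (auto simp: r'_def)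
  have id': "r' (r' x) = r' x" for x
    using r kl by (auto simp: r'_def retraction_def)
  show r': "retraction r'"
    unfolding retraction_def using r kl le' id' by (auto simp: r'_def retraction_def)
  have moved': "moved r' = insert l (moved r)"
    using kl le by (auto simp: moved_def r'_def)
  have adm: "admissible r (moved r)" by (rule retraction_admissible[OF r])
  have adm': "admissible r' (insert l (moved r))"
    using retraction_admissible[OF r'] by (simp add: moved')
  have notin: "k \<notin> moved r" "l \<notin> moved r" using kl by (auto simp: moved_def)
  have "el_prod r S * el k l = el k l * el_prod r' S" if "finite S" "S \<subseteq> moved r" for S
    using that
  proof (induction S rule: finite_induct)
    case (insert x S)
    have adms: "admissible r (insert x S)" "admissible r' (insert x S)"
      using insert admissible_mono[OF adm] admissible_mono[OF adm', of "insert x S"] by auto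
    have x: "x \<in> {1..n}" "x \<notin> {k, l}" "r x \<in> {1..n}" "r x \<noteq> x"
      using insert adms(1) notin by (auto simp: admissible_def)
    have "el_prod r (insert x S) * el k l = el (r x) x * (el_prod r S * el k l)"
      using insert adms by (simp add: el_prod_insert mult.assoc)
    also have "el_prod r S * el k l = el k l * el_prod r' S" using insert by simp
    also have "el (r x) x * (el k l * el_prod r' S) = (el (r x) x * el k l) * el_prod r' S"
      by (simp only: mult.assoc)
    also have "el (r x) x * el k l = el k l * el (r' x) x"
    proof (cases "r x = l")
      case True
      thus ?thesis using x kl by (auto simp: r'_def intro!: el_merge)
    next
      case False
      thus ?thesis using x kl by (auto simp: r'_def intro!: el_commute)
    qed
    finally show ?case using insert adms by (simp add: el_prod_insert mult.assoc)
  qed (simp add: el_prod_empty)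
  from this[OF admissible_finite[OF adm]] have "ret_prod r * el k l = el k l * el_prod r' (moved r)"
    by (simp add: ret_prod_def)
  moreover have "r' l = k" using kl by (simp add: r'_def)
  ultimately show "ret_prod r * el k l = ret_prod r'"
    using el_prod_insert[OF adm' notin(2)] by (simp add: ret_prod_def moved')
qed

text \<open>Every element of the monoid is written as \<open>ret_prod r * h p\<close>, where \<open>r\<close> is determined by the
  kernel of the transformation \<open>f = p \<circ> r\<close>.\<close>

definition normal_form :: "(nat \<Rightarrow> nat) \<Rightarrow> 'm \<Rightarrow> bool" where
  "normal_form f m \<longleftrightarrow>
     (\<exists>r p. retraction r \<and> p permutes {1..n} \<and> f = p \<circ> r \<and> m = ret_prod r * h p)"

lemma normal_form_id: "normal_form id 1"
proof -
  have "retraction id" "moved id = {}" by (auto simp: retraction_def moved_def)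
  hence "retraction id \<and> id permutes {1..n} \<and> id = id \<circ> id \<and> 1 = ret_prod id * h id"
    using h_id permutes_id by (simp add: ret_prod_def el_prod_empty)
  thus ?thesis unfolding normal_form_def by blast
qed

lemma normal_form_mult_h:
  assumes "normal_form f m" "q permutes {1..n}"
  shows "normal_form (q \<circ> f) (m * h q)"
proof -
  obtain r p where "retraction r" "p permutes {1..n}" "f = p \<circ> r" "m = ret_prod r * h p"
    using assms(1) unfolding normal_form_def by blast
  moreover from this have "m * h q = ret_prod r * h (q \<circ> p)"
    using assms(2) by (simp add: h_comp mult.assoc)
  ultimately show ?thesis
    unfolding normal_form_def using assms(2) by (metis comp_assoc permutes_compose)
qed

lemma ret_prod_el:
  assumes r: "retraction r" and kl: "k \<in> {1..n}" "l \<in> {1..n}" "k \<noteq> l"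
  shows "normal_form (id(l := k) \<circ> r) (ret_prod r * el k l)"
proof -
  have idem: "r (r x) = r x" for x using r by (simp add: retraction_def)
  have tr: "transpose k l permutes {1..n}" using kl by (intro transpose_permutes)
  have ranges: "r x \<noteq> y" if "y \<in> moved r" for x y using that idem by (auto simp: moved_def)
  have witness: "normal_form (id(l := k) \<circ> r) (ret_prod r * el k l)"
    if "retraction r'" "p permutes {1..n}" "id(l := k) \<circ> r = p \<circ> r'" "ret_prod r * el k l = ret_prod r' * h p"
    for r' p using that unfolding normal_form_def by blast
  \<comment> \<open>The moved points are those outside the image of r. If l is one of them,
    replacing l by k has no effect; if only k is, (k,l) has the same effect on the image. Otherwise
    two kernel classes merge, and the smaller of k and l represents the union; for l < k a
    transposition corrects the value.\<close>
  consider "l \<in> moved r" | "l \<notin> moved r" "k \<in> moved r" | "l \<notin> moved r" "k \<notin> moved r" "k < l"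
    | "l \<notin> moved r" "k \<notin> moved r" "l < k"
    using kl by fastforce
  thus ?thesis
  proof cases
    case 1
    show ?thesis
      using 1 kl by (intro witness[OF r permutes_id])
        (auto simp: fun_eq_iff ranges h_id ret_prod_absorb[OF r])
  next
    case 2
    show ?thesis
      using 2 kl by (intro witness[OF r tr])
        (auto simp: fun_eq_iff ranges transpose_def ret_prod_shift[OF r])
  next
    case 3
    hence fixed: "r k = k" "r l = l" by (auto simp: moved_def)
    note merge = ret_prod_merge[OF r kl(1,2) fixed 3(3)]
    show ?thesis
      by (rule witness[OF merge(1) permutes_id]) (auto simp: fun_eq_iff h_id merge(2))
  next
    case 4
    hence fixed: "r k = k" "r l = l" by (auto simp: moved_def)
    note merge = ret_prod_merge[OF r kl(2,1) fixed(2,1) 4(3)]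
    have "el k l = el l k * h (transpose k l)"
      using el_swap[of l k] kl by (simp add: transpose_commute)
    hence "ret_prod r * el k l = ret_prod r * el l k * h (transpose k l)" by (simp add: mult.assoc)
    thus ?thesis
      by (intro witness[OF merge(1) tr]) (use kl(3) in \<open>auto simp: fun_eq_iff merge(2)\<close>)
  qed
qed

text \<open>Moving e to the left past \<open>h p\<close> changes its labels 1 and 2 into their
  preimages k and l under p, and \<open>ret_prod_el\<close> takes over.\<close>

lemma normal_form_mult_e:
  assumes "normal_form f m"
  shows "normal_form (zeta_map \<circ> f) (m * e)"
proof -
  obtain r p where r: "retraction r" and p: "p permutes {1..n}" and f: "f = p \<circ> r"
    and m: "m = ret_prod r * h p"
    using assms(1) unfolding normal_form_def by blast
  define k l where "k = pinv p 1" and "l = pinv p 2"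
  have pkl: "p k = 1" "p l = 2" using permutes_pinv_apply(1)[OF p] by (auto simp: k_def l_def)
  have "k \<noteq> l" using pkl by auto
  moreover have "k \<in> {1..n}" "l \<in> {1..n}"
    using permutes_in_image[OF permutes_inv[OF p]] n_ge by (auto simp: k_def l_def)
  ultimately have nf: "normal_form (id(l := k) \<circ> r) (ret_prod r * el k l)"
    by (intro ret_prod_el r)
  have "h p * e = conjugate (pinv p) e * h p"
    using h_conj[OF p, of "conjugate (pinv p) e"] by (simp add: conj_pinv[OF p])
  hence "m * e = ret_prod r * el k l * h p"
    using conj_e[OF permutes_inv[OF p]] by (simp add: m k_def l_def mult.assoc)
  moreover have "zeta_map \<circ> f = p \<circ> (id(l := k) \<circ> r)"
  proof
    fix x
    have "r x = l \<longleftrightarrow> p (r x) = 2" using pkl permutes_inj[OF p] by (metis injD)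
    thus "(zeta_map \<circ> f) x = (p \<circ> (id(l := k) \<circ> r)) x" by (auto simp: zeta_map_def f pkl)
  qed
  ultimately show ?thesis using normal_form_mult_h[OF nf p] by simp
qed

text \<open>Both retractions select the least element of each kernel class of f, so they coincide.
  The permutations then agree on the fixed points of r, so they differ by a permutation of the moved
  points, which \<open>ret_prod_h\<close> absorbs.\<close>

lemma normal_form_unique:
  assumes "normal_form f m" "normal_form f m'"
  shows "m = m'"
proof -
  obtain r p where r: "retraction r" and p: "p permutes {1..n}" and f: "f = p \<circ> r"
    and m: "m = ret_prod r * h p"
    using assms(1) unfolding normal_form_def by blast
  obtain r' p' where r': "retraction r'" and p': "p' permutes {1..n}" and f': "f = p' \<circ> r'"
    and m': "m' = ret_prod r' * h p'"
    using assms(2) unfolding normal_form_def by blast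
  have ker: "f x = f y \<longleftrightarrow> r x = r y" "f x = f y \<longleftrightarrow> r' x = r' y" for x y
    using fun_cong[OF f] fun_cong[OF f'] inj_eq[OF permutes_inj[OF p]] inj_eq[OF permutes_inj[OF p']]
    by (metis comp_apply)+
  have "r x = r' x" for x
  proof (rule antisym)
    have "r (r' x) = r x" "r' (r x) = r' x"
      using ker r r' by (auto simp: retraction_def)
    thus "r x \<le> r' x" "r' x \<le> r x" using r r' unfolding retraction_def by metis+
  qed
  hence rr: "r' = r" by auto
  define q where "q = pinv p \<circ> p'"
  have q: "q permutes {1..n}" unfolding q_def by (intro permutes_compose permutes_inv p p')
  have "q x = x" if "x \<notin> moved r" for x
  proof -
    have "p' x = p x" using that fun_cong[OF f, of x] fun_cong[OF f', of x] by (simp add: rr moved_def)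
    thus ?thesis by (simp add: q_def permutes_pinv_apply[OF p])
  qed
  hence "q permutes moved r" by (metis DiffE permutes_superset[OF q])
  hence "ret_prod r * h q = ret_prod r" by (rule ret_prod_h[OF r])
  moreover have "p' = p \<circ> q" by (simp add: q_def fun_eq_iff permutes_pinv_apply[OF p])
  ultimately show ?thesis using h_comp[OF q p] by (simp add: m m' rr flip: mult.assoc)
qed

end

subsection \<open>Words and congruences\<close>

lemma word_congruenceI:
  assumes "E \<subseteq> lists X \<times> lists X" "\<And>u. u \<in> lists X \<Longrightarrow> (u, u) \<in> E"
    "\<And>u v. (u, v) \<in> E \<Longrightarrow> (v, u) \<in> E"
    "\<And>u v w. (u, v) \<in> E \<Longrightarrow> (v, w) \<in> E \<Longrightarrow> (u, w) \<in> E"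
    "\<And>u v u' v'. (u, v) \<in> E \<Longrightarrow> (u', v') \<in> E \<Longrightarrow> (u @ u', v @ v') \<in> E"
  shows "word_congruence X E"
  unfolding word_congruence_def
  using assms by (intro conjI equivI refl_onI symI transI) (assumption | blast)+

lemma word_congruenceD:
  assumes "word_congruence X E"
  shows "(u, v) \<in> E \<Longrightarrow> u \<in> lists X \<and> v \<in> lists X" "u \<in> lists X \<Longrightarrow> (u, u) \<in> E"
    "(u, v) \<in> E \<Longrightarrow> (v, u) \<in> E" "(u, v) \<in> E \<Longrightarrow> (v, w) \<in> E \<Longrightarrow> (u, w) \<in> E"
    "(u, v) \<in> E \<Longrightarrow> (u', v') \<in> E \<Longrightarrow> (u @ u', v @ v') \<in> E"
proof -
  have *: "E \<subseteq> lists X \<times> lists X" "refl_on (lists X) E" "sym E" "trans E"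
    "\<forall>u v u' v'. (u, v) \<in> E \<and> (u', v') \<in> E \<longrightarrow> (u @ u', v @ v') \<in> E"
    using assms unfolding word_congruence_def equiv_def by auto
  show "(u, v) \<in> E \<Longrightarrow> u \<in> lists X \<and> v \<in> lists X" using *(1) by blast
  show "u \<in> lists X \<Longrightarrow> (u, u) \<in> E" using *(2) by (rule refl_onD)
  show "(u, v) \<in> E \<Longrightarrow> (v, u) \<in> E" using *(3) by (rule symD)
  show "(u, v) \<in> E \<Longrightarrow> (v, w) \<in> E \<Longrightarrow> (u, w) \<in> E" using *(4) by (rule transD)
  show "(u, v) \<in> E \<Longrightarrow> (u', v') \<in> E \<Longrightarrow> (u @ u', v @ v') \<in> E" using *(5) by blast
qed

lemma word_congruence_restrict:
  assumes "word_congruence X E" "A \<subseteq> X"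
  shows "word_congruence A (E \<inter> lists A \<times> lists A)"
proof -
  note E = word_congruenceD[OF assms(1)]
  have "lists A \<subseteq> lists X" using assms(2) by (rule lists_mono)
  thus ?thesis
    by (intro word_congruenceI) (auto intro: E(2,3) E(4,5))
qed

lemma generated_congruence_least:
  "word_congruence X E \<Longrightarrow> Q \<subseteq> E \<Longrightarrow> generated_congruence X Q \<subseteq> E"
  by (auto simp: generated_congruence_def)

text \<open>Functions under composition get a type of their own so that they form an instance of
  \<open>monoid_mult\<close>, as \<open>transf_relations\<close> requires.\<close>

typedef 'a endo = "UNIV :: ('a \<Rightarrow> 'a) set"
  morphisms apply_endo Endo ..

setup_lifting type_definition_endo

instantiation endo :: (type) monoid_mult
begin

lift_definition one_endo :: "'a endo" is id .

lift_definition times_endo :: "'a endo \<Rightarrow> 'a endo \<Rightarrow> 'a endo" is "(\<circ>)" .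

instance by standard (transfer; simp add: comp_assoc)+

end

text \<open>The quotient of the free monoid by a congruence embeds into a monoid of functions by its left
  regular representation, which acts on chosen representatives of the classes.\<close>

lemma congruence_as_kernel:
  fixes E :: "('x list \<times> 'x list) set"
  assumes "word_congruence X E"
  obtains F :: "'x list \<Rightarrow> 'x list endo"
  where "F [] = 1" "\<And>u v. u \<in> lists X \<Longrightarrow> v \<in> lists X \<Longrightarrow> F (u @ v) = F u * F v"
    "\<And>u v. u \<in> lists X \<Longrightarrow> v \<in> lists X \<Longrightarrow> F u = F v \<longleftrightarrow> (u, v) \<in> E"
proof -
  note E = word_congruenceD[OF assms]
  define c where "c w = (SOME v. (w, v) \<in> E)" for w
  have c: "(w, c w) \<in> E" if "w \<in> lists X" for w
    unfolding c_def using E(2)[OF that] by (rule someI)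
  have c_lists: "c w \<in> lists X" if "w \<in> lists X" for w using E(1)[OF c[OF that]] by simp
  have c_eq: "c u = c v" if "(u, v) \<in> E" for u v
  proof -
    have "(u, w) \<in> E \<longleftrightarrow> (v, w) \<in> E" for w using that E(3,4) by blast
    thus ?thesis by (simp add: c_def)
  qed
  have c_c: "c (c w) = c w" if "w \<in> lists X" for w
    using c_eq[OF c[OF that]] by simp
  define f where "f w v = (if v \<in> lists X \<and> c v = v then c (w @ v) else v)" for w v
  have f_append: "f (u @ v) = f u \<circ> f v" if "u \<in> lists X" "v \<in> lists X" for u v
  proof
    fix x
    show "f (u @ v) x = (f u \<circ> f v) x"
    proof (cases "x \<in> lists X \<and> c x = x")
      case True
      hence vx: "v @ x \<in> lists X" using that by simp
      have "(u @ (v @ x), u @ c (v @ x)) \<in> E" using E(2)[OF that(1)] c[OF vx] by (rule E(5))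
      hence "c (u @ v @ x) = c (u @ c (v @ x))" by (rule c_eq)
      thus ?thesis using True vx c_lists[OF vx] c_c[OF vx] by (simp add: f_def)
    qed (auto simp: f_def)
  qed
  have f_eq: "f u = f v \<longleftrightarrow> (u, v) \<in> E" if "u \<in> lists X" "v \<in> lists X" for u v
  proof
    assume "(u, v) \<in> E"
    thus "f u = f v" using E(2,5) c_eq by (fastforce simp: f_def)
  next
    \<comment> \<open>Acting on the representative of the empty word recovers the class of a
      word.\<close>
    assume eq: "f u = f v"
    have nil: "[] \<in> lists X" by simp
    have "(w, c (w @ c [])) \<in> E" if "w \<in> lists X" for w
    proof -
      have "(w @ [], w @ c []) \<in> E" using E(2)[OF that] c[OF nil] by (rule E(5))
      moreover have "(w @ c [], c (w @ c [])) \<in> E" using that c_lists[OF nil] by (intro c) simp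
      ultimately show ?thesis using E(4) by simp
    qed
    moreover have "c (u @ c []) = c (v @ c [])"
      using fun_cong[OF eq, of "c []"] c_lists[OF nil] c_c[OF nil] by (simp add: f_def)
    ultimately show "(u, v) \<in> E" using that E(3,4) by metis
  qed
  show thesis
  proof (rule that[of "\<lambda>w. Endo (f w)"])
    have "f [] = id" by (auto simp: f_def)
    thus "Endo (f []) = 1" by (simp add: one_endo_def)
    show "Endo (f (u @ v)) = Endo (f u) * Endo (f v)" if "u \<in> lists X" "v \<in> lists X" for u v
      using f_append[OF that] by (simp add: times_endo.abs_eq)
    show "Endo (f u) = Endo (f v) \<longleftrightarrow> (u, v) \<in> E" if "u \<in> lists X" "v \<in> lists X" for u v
      using f_eq[OF that] by (simp add: Endo_inject)
  qed
qed

section \<open>Evaluation of words as transformations\<close>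

definition word_map :: "('x \<Rightarrow> nat \<Rightarrow> nat) \<Rightarrow> 'x list \<Rightarrow> nat \<Rightarrow> nat" where
  "word_map \<rho> w = foldr (\<lambda>x m. m \<circ> \<rho> x) w id"

lemma word_map_Nil: "word_map \<rho> [] = id"
  by (simp add: word_map_def)

lemma word_map_Cons: "word_map \<rho> (x # w) = word_map \<rho> w \<circ> \<rho> x"
  by (simp add: word_map_def)

lemma word_map_append: "word_map \<rho> (u @ v) = word_map \<rho> v \<circ> word_map \<rho> u"
  by (induction u) (simp_all add: word_map_Nil word_map_Cons comp_assoc)

lemma word_map_cong: "w \<in> lists X \<Longrightarrow> (\<And>x. x \<in> X \<Longrightarrow> \<rho> x = \<rho>' x) \<Longrightarrow> word_map \<rho> w = word_map \<rho>' w"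
  by (induction w) (auto simp: word_map_Nil word_map_Cons)

lemma word_value_transf: "word_value (full_transf_monoid n) \<rho> = word_map \<rho>"
  by (simp add: fun_eq_iff word_value_def word_map_def full_transf_monoid_def)

lemma word_value_symmetric: "word_value (symmetric_group n) \<rho> = word_map \<rho>"
  by (simp add: fun_eq_iff word_value_def word_map_def symmetric_group_def full_transf_monoid_def)

definition transfs :: "nat \<Rightarrow> (nat \<Rightarrow> nat) set" where
  "transfs n = {f. f ` {1..n} \<subseteq> {1..n} \<and> (\<forall>x. x \<notin> {1..n} \<longrightarrow> f x = x)}"

lemma carrier_transf: "carrier (full_transf_monoid n) = transfs n"
  by (simp add: full_transf_monoid_def transfs_def)

lemma carrier_symmetric: "carrier (symmetric_group n) = {p. p permutes {1..n}}"
  by (simp add: symmetric_group_def)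

lemma transfs_id: "id \<in> transfs n"
  by (simp add: transfs_def)

lemma transfs_comp: "f \<in> transfs n \<Longrightarrow> g \<in> transfs n \<Longrightarrow> g \<circ> f \<in> transfs n"
  by (auto simp: transfs_def image_subset_iff)

lemma permutes_transfs: "p permutes {1..n} \<Longrightarrow> p \<in> transfs n"
  using permutes_image[of p "{1..n}"] permutes_not_in[of p "{1..n}"] by (simp add: transfs_def)

lemma word_map_transfs: "\<rho> ` X \<subseteq> transfs n \<Longrightarrow> w \<in> lists X \<Longrightarrow> word_map \<rho> w \<in> transfs n"
  by (induction w) (auto simp: word_map_Nil word_map_Cons transfs_id intro!: transfs_comp)

lemma inj_on_transfs_permutes:
  "f \<in> transfs n \<Longrightarrow> inj_on f {1..n} \<Longrightarrow> f permutes {1..n}"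
  by (rule inj_imp_permutes) (auto simp: transfs_def image_subset_iff)

definition word_kernel :: "('x \<Rightarrow> nat \<Rightarrow> nat) \<Rightarrow> 'x set \<Rightarrow> ('x list \<times> 'x list) set" where
  "word_kernel \<rho> X = {(u, v). u \<in> lists X \<and> v \<in> lists X \<and> word_map \<rho> u = word_map \<rho> v}"

lemma word_congruence_kernel: "word_congruence X (word_kernel \<rho> X)"
  by (rule word_congruenceI) (auto simp: word_kernel_def word_map_append)

lemma presentation_transf_iff:
  "monoid_presentation (full_transf_monoid n) X Q \<rho> \<longleftrightarrow>
     finite X \<and> finite Q \<and> Q \<subseteq> lists X \<times> lists X \<and> \<rho> ` X \<subseteq> transfs n \<and>
     word_map \<rho> ` lists X = transfs n \<and> word_kernel \<rho> X = generated_congruence X Q"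
  by (simp add: monoid_presentation_def word_value_transf carrier_transf word_kernel_def)

lemma presentation_symmetric_iff:
  "monoid_presentation (symmetric_group n) X Q \<rho> \<longleftrightarrow>
     finite X \<and> finite Q \<and> Q \<subseteq> lists X \<times> lists X \<and> \<rho> ` X \<subseteq> {p. p permutes {1..n}} \<and>
     word_map \<rho> ` lists X = {p. p permutes {1..n}} \<and> word_kernel \<rho> X = generated_congruence X Q"
  by (simp add: monoid_presentation_def word_value_symmetric carrier_symmetric word_kernel_def)

lemma word_products_Nil: "word_products [] = {[]}"
  by (simp add: word_products_def)

lemma word_products_Cons:
  "word_products (L # Ls) = (\<lambda>(u, v). u @ v) ` (L \<times> word_products Ls)"
proof -
  have "listset (L # Ls) = (\<lambda>(u, us). u # us) ` (L \<times> listset Ls)"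
    by (auto simp: set_Cons_def)
  hence "word_products (L # Ls) = (\<lambda>(u, us). u @ concat us) ` (L \<times> listset Ls)"
    by (simp add: word_products_def image_image case_prod_beta)
  also have "\<dots> = (\<lambda>(u, v). u @ v) ` map_prod id concat ` (L \<times> listset Ls)"
    by (simp add: image_image case_prod_beta)
  also have "map_prod id concat ` (L \<times> listset Ls) = L \<times> word_products Ls"
    by (simp add: word_products_def map_prod_surj_on)
  finally show ?thesis .
qed

section \<open>Generation of the full transformation monoid and completeness of the four
  relations\<close>

lemma zeta_map_transfs: "2 \<le> n \<Longrightarrow> zeta_map \<in> transfs n"
  by (auto simp: zeta_map_def transfs_def image_subset_iff)

text \<open>Induction on the defect: a singular map factors through some idempotent of rank \<open>n - 1\<close>.\<close>

lemma transfs_generated: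
  assumes n: "2 \<le> n" and f: "f \<in> transfs n"
    and perms: "\<And>p. p permutes {1..n} \<Longrightarrow> p \<in> G" and zeta: "zeta_map \<in> G"
    and comp: "\<And>f g. f \<in> G \<Longrightarrow> g \<in> G \<Longrightarrow> g \<circ> f \<in> G"
  shows "f \<in> G"
  using f
proof (induction "n - card (f ` {1..n})" arbitrary: f rule: less_induct)
  case less
  show ?case
  proof (cases "inj_on f {1..n}")
    case True
    thus ?thesis using less.prems by (intro perms inj_on_transfs_permutes)
  next
    case False
    then obtain a b where ab: "a \<in> {1..n}" "b \<in> {1..n}" "a \<noteq> b" "f a = f b"
      by (auto simp: inj_on_def)
    have "card (f ` {1..n}) < n"
      using False card_image_le[of "{1..n}" f] eq_card_imp_inj_on[of "{1..n}" f] by fastforce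
    moreover have sub: "f ` {1..n} \<subseteq> {1..n}" using less.prems by (simp add: transfs_def)
    ultimately obtain c where c: "c \<in> {1..n}" "c \<notin> f ` {1..n}"
      by (metis card_atLeastAtMost diff_Suc_1 nat_neq_iff subsetI subset_antisym)
    \<comment> \<open>Redirecting b to a missed value c raises the rank, and f is recovered by first
      mapping b to a. That first map is a conjugate of \<open>zeta_map\<close> by a permutation
      taking 1 to a and 2 to b.\<close>
    define g where "g = f(b := c)"
    have "f ` {1..n} \<subseteq> g ` {1..n}"
    proof
      fix y assume "y \<in> f ` {1..n}"
      then obtain x where x: "x \<in> {1..n}" "y = f x" by blast
      have "y = g (if x = b then a else x)" using x ab by (simp add: g_def)
      moreover have "(if x = b then a else x) \<in> {1..n}" using x ab by simp
      ultimately show "y \<in> g ` {1..n}" by (rule image_eqI)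
    qed
    moreover have "c \<in> g ` {1..n}" using ab by (auto simp: g_def)
    ultimately have "insert c (f ` {1..n}) \<subseteq> g ` {1..n}" by blast
    hence "card (insert c (f ` {1..n})) \<le> card (g ` {1..n})" by (intro card_mono) auto
    hence card_less: "card (f ` {1..n}) < card (g ` {1..n})" using c by simp
    have "g \<in> transfs n" using less.prems c ab by (auto simp: g_def transfs_def image_subset_iff)
    hence "g \<in> G" using card_less \<open>card (f ` {1..n}) < n\<close> by (intro less.hyps) auto
    obtain p where p: "p permutes {1..n}" "\<And>x. x \<in> {1, 2} \<Longrightarrow> p x = (if x = 1 then a else b)"
      using exists_permutes_extending[of "{1..n}" "{1, 2}" "\<lambda>x. if x = 1 then a else b"] ab n
      by (auto simp: inj_on_def)
    have p12: "p 1 = a" "p 2 = b" using p(2)[of 1] p(2)[of 2] by auto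
    have "p \<circ> zeta_map \<circ> pinv p \<in> G"
      by (intro comp perms permutes_inv p zeta)
    moreover have "f = g \<circ> (p \<circ> zeta_map \<circ> pinv p)"
    proof
      fix x
      have "pinv p x = 2 \<longleftrightarrow> x = b" using p12 permutes_pinv_apply[OF p(1)] by metis
      thus "f x = (g \<circ> (p \<circ> zeta_map \<circ> pinv p)) x"
        using ab p12 by (auto simp: g_def zeta_map_def permutes_pinv_apply[OF p(1)])
    qed
    ultimately show ?thesis using comp \<open>g \<in> G\<close> by metis
  qed
qed

text \<open>That the relations hold is checked pointwise, and surjectivity is
  \<open>transfs_generated\<close>. For completeness, every congruence E containing the relations
  gives an instance of \<open>transf_relations\<close>; words of equal value have the same normal
  form there and are thus E-related. Each occurrence of a permutation has its own word.\<close>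

lemma four_relations_present_transfs:
  fixes A :: "'a set"
  assumes n: "7 \<le> n" and A: "monoid_presentation (symmetric_group n) A R \<pi>" and \<zeta>: "\<zeta> \<notin> A"
    and W: "\<And>p. W p = {w \<in> lists A. word_map \<pi> w = p}"
    and u: "u1 \<in> W (transpose 1 n \<circ> transpose 2 3)" "u2 \<in> W (transpose 1 n \<circ> transpose 2 3)"
      "u3 \<in> W (transpose 1 n \<circ> transpose 2 3)" "u4 \<in> W (transpose 1 n \<circ> transpose 2 3)"
    and v: "v1 \<in> W (transpose 2 3)" "v2 \<in> W (transpose 2 3)" "v3 \<in> W (transpose 2 3)"
      "v4 \<in> W (transpose 2 3)" "v5 \<in> W (transpose 2 3)"
    and x: "x1 \<in> W (pinv (alpha n))" "x2 \<in> W (alpha n)" "x3 \<in> W (transpose 1 3)" "x4 \<in> W (transpose 1 3)"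
    and y: "y1 \<in> W (pinv (beta n))" "y2 \<in> W (beta n)" "y3 \<in> W (transpose 1 2)" "y4 \<in> W (transpose 1 3)"
      "y5 \<in> W (transpose 1 3)"
  defines "Q \<equiv> {(u1 @ [\<zeta>] @ u2 @ [\<zeta>], [\<zeta>] @ u3 @ [\<zeta>] @ u4),
      (v1 @ [\<zeta>] @ v2 @ [\<zeta>] @ v3 @ [\<zeta>] @ v4, [\<zeta>] @ v5 @ [\<zeta>]),
      (x1 @ [\<zeta>] @ x2, [\<zeta>] @ x3 @ [\<zeta>] @ x4),
      (y1 @ [\<zeta>] @ y2, y3 @ [\<zeta>] @ y4 @ [\<zeta>] @ y5)}"
  shows "monoid_presentation (full_transf_monoid n) (insert \<zeta> A) (R \<union> Q) (\<pi>(\<zeta> := zeta_map))"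
proof -
  let ?X = "insert \<zeta> A"
  define \<rho> where "\<rho> = \<pi>(\<zeta> := zeta_map)"
  have finA: "finite A" and finR: "finite R" and R: "R \<subseteq> lists A \<times> lists A"
    and \<pi>: "\<pi> ` A \<subseteq> {p. p permutes {1..n}}"
    and onto: "word_map \<pi> ` lists A = {p. p permutes {1..n}}"
    and ker: "word_kernel \<pi> A = generated_congruence A R"
    using A by (simp_all add: presentation_symmetric_iff)
  have AX: "lists A \<subseteq> lists ?X" by (rule lists_mono) auto
  have \<rho>_\<pi>: "word_map \<rho> w = word_map \<pi> w" if "w \<in> lists A" for w
    using that \<zeta> by (intro word_map_cong[of w A]) (auto simp: \<rho>_def)
  have \<rho>_\<zeta>: "word_map \<rho> [\<zeta>] = zeta_map"
    by (simp add: \<rho>_def word_map_Cons word_map_Nil)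
  have WD: "w \<in> lists A" "w \<in> lists ?X" "word_map \<pi> w = p" "word_map \<rho> w = p" if "w \<in> W p" for w p
    using that AX \<rho>_\<pi> by (auto simp: W)
  note lists_A = WD(1)[OF u(1)] WD(1)[OF u(2)] WD(1)[OF u(3)] WD(1)[OF u(4)]
    WD(1)[OF v(1)] WD(1)[OF v(2)] WD(1)[OF v(3)] WD(1)[OF v(4)] WD(1)[OF v(5)]
    WD(1)[OF x(1)] WD(1)[OF x(2)] WD(1)[OF x(3)] WD(1)[OF x(4)]
    WD(1)[OF y(1)] WD(1)[OF y(2)] WD(1)[OF y(3)] WD(1)[OF y(4)] WD(1)[OF y(5)]
  note maps = WD(4)[OF u(1)] WD(4)[OF u(2)] WD(4)[OF u(3)] WD(4)[OF u(4)]
    WD(4)[OF v(1)] WD(4)[OF v(2)] WD(4)[OF v(3)] WD(4)[OF v(4)] WD(4)[OF v(5)]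
    WD(4)[OF x(1)] WD(4)[OF x(2)] WD(4)[OF x(3)] WD(4)[OF x(4)]
    WD(4)[OF y(1)] WD(4)[OF y(2)] WD(4)[OF y(3)] WD(4)[OF y(4)] WD(4)[OF y(5)]
  have lists_X: "w \<in> lists ?X" if "w \<in> lists A" for w using that AX by blast
  have \<zeta>_X: "[\<zeta>] \<in> lists ?X" by simp
  have Q_lists: "Q \<subseteq> lists ?X \<times> lists ?X"
    unfolding Q_def using lists_A[THEN lists_X] by (auto simp del: in_lists_conv_set)
  have \<alpha>: "alpha n permutes {3..n}" and \<beta>: "beta n permutes {3..n}"
    using n by (rule alpha_permutes, rule beta_permutes)
  \<comment> \<open>\<alpha> and \<beta> fix 1 and 2, so the left sides of the last two relations
    evaluate to \<open>zeta_map\<close>.\<close>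
  have conj_zeta: "p \<circ> (zeta_map \<circ> pinv p) = zeta_map" if "p permutes {3..n}" for p
  proof
    fix x
    have "p 1 = 1" "p 2 = 2" using that by (auto intro: permutes_not_in)
    moreover from this have "pinv p x = 2 \<longleftrightarrow> x = 2" using permutes_pinv_apply[OF that] by metis
    ultimately show "(p \<circ> (zeta_map \<circ> pinv p)) x = zeta_map x"
      by (auto simp: zeta_map_def permutes_pinv_apply[OF that])
  qed
  have Q_kernel: "Q \<subseteq> word_kernel \<rho> ?X"
  proof -
    have "word_map \<rho> (fst q) = word_map \<rho> (snd q)" if "q \<in> Q" for q
      using that unfolding Q_def
    proof (elim insertE emptyE, goal_cases)
      case 1
      show ?case unfolding 1 fst_conv snd_conv word_map_append \<rho>_\<zeta> maps
        using n by (auto simp: fun_eq_iff transpose_def zeta_map_def)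
    next
      case 2
      show ?case unfolding 2 fst_conv snd_conv word_map_append \<rho>_\<zeta> maps
        by (auto simp: fun_eq_iff transpose_def zeta_map_def)
    next
      case 3
      show ?case unfolding 3 fst_conv snd_conv word_map_append \<rho>_\<zeta> maps comp_assoc conj_zeta[OF \<alpha>]
        by (auto simp: fun_eq_iff transpose_def zeta_map_def)
    next
      case 4
      show ?case unfolding 4 fst_conv snd_conv word_map_append \<rho>_\<zeta> maps comp_assoc conj_zeta[OF \<beta>]
        by (auto simp: fun_eq_iff transpose_def zeta_map_def)
    qed
    moreover have "fst q \<in> lists ?X \<and> snd q \<in> lists ?X" if "q \<in> Q" for q
      using Q_lists that by (metis mem_Times_iff subsetD)
    ultimately show ?thesis unfolding word_kernel_def by (simp add: subset_iff case_prod_beta)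
  qed
  have "R \<subseteq> word_kernel \<pi> A" unfolding ker by (auto simp: generated_congruence_def)
  moreover have "word_kernel \<pi> A \<subseteq> word_kernel \<rho> ?X"
  proof
    fix z assume "z \<in> word_kernel \<pi> A"
    then obtain a b where z: "z = (a, b)" "a \<in> lists A" "b \<in> lists A" "word_map \<pi> a = word_map \<pi> b"
      unfolding word_kernel_def by blast
    thus "z \<in> word_kernel \<rho> ?X" unfolding word_kernel_def using \<rho>_\<pi> lists_X by simp
  qed
  ultimately have R_kernel: "R \<subseteq> word_kernel \<rho> ?X" by blast
  have \<rho>_transfs: "\<rho> ` ?X \<subseteq> transfs n"
    using \<pi> \<zeta> zeta_map_transfs[of n] n by (auto simp: \<rho>_def permutes_transfs)
  have "f \<in> word_map \<rho> ` lists ?X" if "f \<in> transfs n" for f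
  proof (rule transfs_generated[OF _ that])
    show "2 \<le> n" using n by simp
    show "p \<in> word_map \<rho> ` lists ?X" if "p permutes {1..n}" for p
    proof -
      have "p \<in> word_map \<pi> ` lists A" using onto that by simp
      then obtain w where w: "w \<in> lists A" "p = word_map \<pi> w" by (rule imageE)
      thus ?thesis using \<rho>_\<pi>[OF w(1)] by (intro image_eqI[OF _ lists_X[OF w(1)]]) simp
    qed
    show "zeta_map \<in> word_map \<rho> ` lists ?X" using \<rho>_\<zeta> by (intro image_eqI[OF _ \<zeta>_X]) simp
    show "g \<circ> f \<in> word_map \<rho> ` lists ?X"
      if "f \<in> word_map \<rho> ` lists ?X" "g \<in> word_map \<rho> ` lists ?X" for f g
    proof -
      obtain w where "f = word_map \<rho> w" "w \<in> lists ?X"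
        using \<open>f \<in> word_map \<rho> ` lists ?X\<close> by (rule imageE)
      moreover obtain w' where "g = word_map \<rho> w'" "w' \<in> lists ?X"
        using \<open>g \<in> word_map \<rho> ` lists ?X\<close> by (rule imageE)
      ultimately show ?thesis by (intro image_eqI[of _ _ "w @ w'"]) (simp_all add: word_map_append)
    qed
  qed
  hence surj: "word_map \<rho> ` lists ?X = transfs n"
    using word_map_transfs[OF \<rho>_transfs] by blast
  have complete: "word_kernel \<rho> ?X \<subseteq> E" if E: "word_congruence ?X E" "R \<union> Q \<subseteq> E" for E
  proof -
    obtain F :: "'a list \<Rightarrow> 'a list endo" where F_Nil: "F [] = 1"
      and F_append: "\<And>u v. u \<in> lists ?X \<Longrightarrow> v \<in> lists ?X \<Longrightarrow> F (u @ v) = F u * F v"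
      and F_eq: "\<And>u v. u \<in> lists ?X \<Longrightarrow> v \<in> lists ?X \<Longrightarrow> F u = F v \<longleftrightarrow> (u, v) \<in> E"
      using congruence_as_kernel[OF E(1)] by blast
    \<comment> \<open>The restriction of E to words over A is a congruence containing R, hence
      contains the kernel of \<pi>. Therefore F on such words depends only on the permutation they
      represent, which makes h a homomorphism.\<close>
    have "generated_congruence A R \<subseteq> E \<inter> lists A \<times> lists A"
      using R E(2) by (intro generated_congruence_least word_congruence_restrict[OF E(1)]) auto
    hence E_A: "(u, v) \<in> E" if "u \<in> lists A" "v \<in> lists A" "word_map \<pi> u = word_map \<pi> v" for u v
      using that unfolding ker[symmetric] by (auto simp: word_kernel_def)
    define wd where "wd p = (SOME w. w \<in> lists A \<and> word_map \<pi> w = p)" for p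
    have wd: "wd p \<in> lists A \<and> word_map \<pi> (wd p) = p" if "p permutes {1..n}" for p
    proof -
      have "p \<in> word_map \<pi> ` lists A" using onto that by simp
      hence "\<exists>w. w \<in> lists A \<and> word_map \<pi> w = p" by (elim imageE) auto
      thus ?thesis unfolding wd_def by (rule someI_ex)
    qed
    have perm: "word_map \<pi> w permutes {1..n}" if "w \<in> lists A" for w
      using imageI[OF that, of "word_map \<pi>"] unfolding onto by simp
    define h where "h p = F (wd p)" for p
    have F_h: "F w = h (word_map \<pi> w)" if "w \<in> lists A" for w
      unfolding h_def using F_eq[OF lists_X lists_X] E_A wd[OF perm[OF that]] that by auto
    have F_W: "F w = h p" if "w \<in> W p" for w p using F_h[OF WD(1)[OF that]] WD(3)[OF that] by simp
    have h_comp: "h (q \<circ> p) = h p * h q" if "p permutes {1..n}" "q permutes {1..n}" for p q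
    proof -
      have "wd p @ wd q \<in> lists A" using wd that by simp
      hence "F (wd p @ wd q) = h (q \<circ> p)" using F_h wd that by (simp add: word_map_append)
      thus ?thesis using F_append[OF lists_X lists_X] wd that by (simp add: h_def)
    qed
    have h_id: "h id = 1" using F_h[of "[]"] by (simp add: F_Nil word_map_Nil)
    have rel: "F l = F r" if "(l, r) \<in> Q" for l r
      using that E(2) Q_lists F_eq by blast
    note F_simps = F_append append_in_lists_conv \<zeta>_X lists_A[THEN lists_X]
    note F_values = F_W[OF u(1)] F_W[OF u(2)] F_W[OF u(3)] F_W[OF u(4)]
      F_W[OF v(1)] F_W[OF v(2)] F_W[OF v(3)] F_W[OF v(4)] F_W[OF v(5)]
      F_W[OF x(1)] F_W[OF x(2)] F_W[OF x(3)] F_W[OF x(4)]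
      F_W[OF y(1)] F_W[OF y(2)] F_W[OF y(3)] F_W[OF y(4)] F_W[OF y(5)]
    interpret transf_relations n h "F [\<zeta>]"
    proof
      show "7 \<le> n" "h id = 1" by fact+
      show "h (q \<circ> p) = h p * h q" if "p permutes {1..n}" "q permutes {1..n}" for p q
        by (rule h_comp[OF that])
    next
      let ?t = "transpose 1 n \<circ> transpose 2 3"
      have "F (u1 @ [\<zeta>] @ u2 @ [\<zeta>]) = F ([\<zeta>] @ u3 @ [\<zeta>] @ u4)" by (rule rel) (simp add: Q_def)
      thus "h ?t * F [\<zeta>] * h ?t * F [\<zeta>] = F [\<zeta>] * h ?t * F [\<zeta>] * h ?t"
        by (simp only: F_simps F_values mult.assoc simp_thms)
    next
      let ?t = "transpose 2 3"
      have "F (v1 @ [\<zeta>] @ v2 @ [\<zeta>] @ v3 @ [\<zeta>] @ v4) = F ([\<zeta>] @ v5 @ [\<zeta>])"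
        by (rule rel) (simp add: Q_def)
      thus "h ?t * F [\<zeta>] * h ?t * F [\<zeta>] * h ?t * F [\<zeta>] * h ?t = F [\<zeta>] * h ?t * F [\<zeta>]"
        by (simp only: F_simps F_values mult.assoc simp_thms)
    next
      have "F (x1 @ [\<zeta>] @ x2) = F ([\<zeta>] @ x3 @ [\<zeta>] @ x4)" by (rule rel) (simp add: Q_def)
      thus "h (pinv (alpha n)) * F [\<zeta>] * h (alpha n)
          = F [\<zeta>] * h (transpose 1 3) * F [\<zeta>] * h (transpose 1 3)"
        by (simp only: F_simps F_values mult.assoc simp_thms)
    next
      have "F (y1 @ [\<zeta>] @ y2) = F (y3 @ [\<zeta>] @ y4 @ [\<zeta>] @ y5)" by (rule rel) (simp add: Q_def)
      thus "h (pinv (beta n)) * F [\<zeta>] * h (beta n)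
          = h (transpose 1 2) * F [\<zeta>] * h (transpose 1 3) * F [\<zeta>] * h (transpose 1 3)"
        by (simp only: F_simps F_values mult.assoc simp_thms)
    qed
    \<comment> \<open>Normal forms are multiplied on the right, so words are built up by appending
      letters.\<close>
    have nf: "normal_form (word_map \<rho> w) (F w)" if "w \<in> lists ?X" for w
      using that
    proof (induction w rule: rev_induct)
      case Nil show ?case unfolding word_map_Nil F_Nil by (rule normal_form_id)
    next
      case (snoc x w)
      hence w: "w \<in> lists ?X" and x: "x \<in> ?X" by auto
      have nf_w: "normal_form (word_map \<rho> w) (F w)" by (rule snoc.IH[OF w])
      have F_snoc: "F (w @ [x]) = F w * F [x]" using w x by (intro F_append) auto
      show ?case
      proof (cases "x = \<zeta>")
        case True
        show ?thesis using normal_form_mult_e[OF nf_w] 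
          unfolding F_snoc word_map_append unfolding True \<rho>_\<zeta> .
      next
        case False
        hence xA: "[x] \<in> lists A" using x by simp
        show ?thesis
          using normal_form_mult_h[OF nf_w perm[OF xA]]
          unfolding F_snoc word_map_append \<rho>_\<pi>[OF xA] F_h[OF xA] .
      qed
    qed
    show ?thesis
    proof
      fix z assume "z \<in> word_kernel \<rho> ?X"
      then obtain w w' where z: "z = (w, w')" "w \<in> lists ?X" "w' \<in> lists ?X"
        "word_map \<rho> w = word_map \<rho> w'" by (auto simp: word_kernel_def)
      hence "F w = F w'" using nf normal_form_unique by metis
      thus "z \<in> E" using z F_eq by blast
    qed
  qed
  have "word_kernel \<rho> ?X = generated_congruence ?X (R \<union> Q)"
  proof
    show "word_kernel \<rho> ?X \<subseteq> generated_congruence ?X (R \<union> Q)"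
      using complete by (auto simp: generated_congruence_def)
    show "generated_congruence ?X (R \<union> Q) \<subseteq> word_kernel \<rho> ?X"
      using R_kernel Q_kernel by (intro generated_congruence_least word_congruence_kernel) auto
  qed
  moreover have "R \<union> Q \<subseteq> lists ?X \<times> lists ?X" using R AX Q_lists by blast
  moreover have "finite Q" by (simp add: Q_def)
  ultimately have "monoid_presentation (full_transf_monoid n) ?X (R \<union> Q) \<rho>"
    using finA finR \<rho>_transfs surj by (simp add: presentation_transf_iff)
  thus ?thesis by (simp add: \<rho>_def)
qed

subsection \<open>Kernels and the lower bound\<close>

lemma inj_transfs_permutes: "f \<in> transfs n \<Longrightarrow> inj f \<Longrightarrow> f permutes {1..n}"
  using inj_on_transfs_permutes inj_on_subset by blast

lemma inj_comp_iff:
  assumes "f \<in> transfs n" "g \<in> transfs n"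
  shows "inj (g \<circ> f) \<longleftrightarrow> inj f \<and> inj g"
proof
  assume gf: "inj (g \<circ> f)"
  hence f: "inj f" by (rule inj_on_imageI2)
  hence "surj f" using inj_transfs_permutes[OF assms(1)] permutes_surj by blast
  moreover have "inj_on g (range f)" using gf by (rule inj_on_imageI)
  ultimately show "inj f \<and> inj g" using f by simp
qed (auto intro: inj_compose)

section \<open>Kernel types of transformations\<close>

definition same_kernel :: "(nat \<Rightarrow> nat) \<Rightarrow> (nat \<Rightarrow> nat) \<Rightarrow> bool" where
  "same_kernel f g \<longleftrightarrow> (\<forall>x y. f x = f y \<longleftrightarrow> g x = g y)"

definition kernel_le :: "(nat \<Rightarrow> nat) \<Rightarrow> (nat \<Rightarrow> nat) \<Rightarrow> bool" where
  "kernel_le f g \<longleftrightarrow> (\<forall>x y. f x = f y \<longrightarrow> g x = g y)"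

text \<open>The kernels of rank n - 1. The two kernel types of rank n - 2 follow: two classes of
  size 2, or one class of size 3.\<close>

definition kernel_pair :: "(nat \<Rightarrow> nat) \<Rightarrow> bool" where
  "kernel_pair f \<longleftrightarrow> (\<exists>a b. a \<noteq> b \<and> (\<forall>x y. f x = f y \<longleftrightarrow> x = y \<or> {x, y} = {a, b}))"

definition kernel_two_pairs :: "(nat \<Rightarrow> nat) \<Rightarrow> bool" where
  "kernel_two_pairs f \<longleftrightarrow> (\<exists>a b c d. distinct [a, b, c, d] \<and>
     (\<forall>x y. f x = f y \<longleftrightarrow> x = y \<or> {x, y} = {a, b} \<or> {x, y} = {c, d}))"

definition kernel_triple :: "(nat \<Rightarrow> nat) \<Rightarrow> bool" where
  "kernel_triple f \<longleftrightarrow> (\<exists>a b c. distinct [a, b, c] \<and>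
     (\<forall>x y. f x = f y \<longleftrightarrow> x = y \<or> {x, y} \<subseteq> {a, b, c}))"

lemma kernel_le_comp: "kernel_le f (g \<circ> f)"
  by (simp add: kernel_le_def)

lemma kernel_not_inj:
  "kernel_pair f \<Longrightarrow> \<not> inj f" "kernel_two_pairs f \<Longrightarrow> \<not> inj f" "kernel_triple f \<Longrightarrow> \<not> inj f"
proof -
  have not_inj: "\<not> inj f" if "f a = f b" "a \<noteq> b" for a b using that by (auto dest: injD)
  show "\<not> inj f" if pair: "kernel_pair f"
  proof -
    obtain a b where "a \<noteq> b" "\<forall>x y. f x = f y \<longleftrightarrow> x = y \<or> {x, y} = {a, b}"
      using pair unfolding kernel_pair_def by (elim exE conjE)
    thus ?thesis by (intro not_inj[of a b]) simp_all
  qed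
  show "\<not> inj f" if two: "kernel_two_pairs f"
  proof -
    obtain a b c d where "distinct [a, b, c, d]"
      "\<forall>x y. f x = f y \<longleftrightarrow> x = y \<or> {x, y} = {a, b} \<or> {x, y} = {c, d}"
      using two unfolding kernel_two_pairs_def by (elim exE conjE)
    thus ?thesis by (intro not_inj[of a b]) simp_all
  qed
  show "\<not> inj f" if triple: "kernel_triple f"
  proof -
    obtain a b c where "distinct [a, b, c]" "\<forall>x y. f x = f y \<longleftrightarrow> x = y \<or> {x, y} \<subseteq> {a, b, c}"
      using triple unfolding kernel_triple_def by (elim exE conjE)
    thus ?thesis by (intro not_inj[of a b]) simp_all
  qed
qed

text \<open>A kernel with one nontrivial pair is an atom among equivalence relations.\<close>

lemma kernel_pair_minimal:
  assumes "kernel_pair f" "kernel_le g f" "\<not> inj g"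
  shows "same_kernel g f"
proof -
  obtain a b where ab: "a \<noteq> b" "\<And>x y. f x = f y \<longleftrightarrow> x = y \<or> {x, y} = {a, b}"
    using assms(1) by (auto simp: kernel_pair_def)
  obtain x y where xy: "x \<noteq> y" "g x = g y" using assms(3) by (auto simp: inj_def)
  hence "{x, y} = {a, b}" using assms(2) ab(2) by (auto simp: kernel_le_def)
  hence "g a = g b" using xy by (auto simp: doubleton_eq_iff)
  hence "g x = g y \<longleftrightarrow> x = y \<or> {x, y} = {a, b}" for x y
    using assms(2) ab(2) by (auto simp: kernel_le_def doubleton_eq_iff)
  thus ?thesis using ab(2) by (simp add: same_kernel_def)
qed

lemma kernel_two_pairs_below:
  assumes "kernel_two_pairs f" "kernel_le g f" "\<not> inj g"
  shows "kernel_two_pairs g \<or> kernel_pair g"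
proof -
  obtain a b c d where d: "distinct [a, b, c, d]"
    and f: "\<And>x y. f x = f y \<longleftrightarrow> x = y \<or> {x, y} = {a, b} \<or> {x, y} = {c, d}"
    using assms(1) by (auto simp: kernel_two_pairs_def)
  have g: "x = y \<or> {x, y} = {a, b} \<or> {x, y} = {c, d}" if "g x = g y" for x y
    using that assms(2) f by (auto simp: kernel_le_def)
  obtain x y where xy: "x \<noteq> y" "g x = g y" using assms(3) by (auto simp: inj_def)
  have "g a = g b \<or> g c = g d" using g[OF xy(2)] xy by (auto simp: doubleton_eq_iff)
  then consider "g a = g b" "g c = g d" | "g a = g b" "g c \<noteq> g d" | "g a \<noteq> g b" "g c = g d"
    by blast
  thus ?thesis
  proof cases
    case 1
    have "g x = g y \<longleftrightarrow> x = y \<or> {x, y} = {a, b} \<or> {x, y} = {c, d}" for x y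
      using 1 g[of x y] by (auto simp: doubleton_eq_iff)
    thus ?thesis using d unfolding kernel_two_pairs_def by blast
  next
    case 2
    have "g x = g y \<longleftrightarrow> x = y \<or> {x, y} = {a, b}" for x y
      using 2 g[of x y] by (auto simp: doubleton_eq_iff)
    moreover have "a \<noteq> b" using d by simp
    ultimately show ?thesis unfolding kernel_pair_def by blast
  next
    case 3
    have "g x = g y \<longleftrightarrow> x = y \<or> {x, y} = {c, d}" for x y
      using 3 g[of x y] by (auto simp: doubleton_eq_iff)
    moreover have "c \<noteq> d" using d by simp
    ultimately show ?thesis unfolding kernel_pair_def by blast
  qed
qed

text \<open>A non-injective g identifies some p and q among the three points; the type then depends
  on whether the third point r joins them.\<close>

lemma kernel_triple_below:
  assumes "kernel_triple f" "kernel_le g f" "\<not> inj g"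
  shows "kernel_triple g \<or> kernel_pair g"
proof -
  obtain a b c where d: "distinct [a, b, c]"
    and f: "\<forall>x y. f x = f y \<longleftrightarrow> x = y \<or> {x, y} \<subseteq> {a, b, c}"
    using assms(1) unfolding kernel_triple_def by (elim exE conjE)
  have g: "x = y \<or> {x, y} \<subseteq> {a, b, c}" if "g x = g y" for x y
    using that assms(2) f by (auto simp: kernel_le_def)
  obtain p q where pq: "p \<noteq> q" "g p = g q" using assms(3) by (auto simp: inj_def)
  hence pq_abc: "{p, q} \<subseteq> {a, b, c}" using g by blast
  obtain r where r: "{a, b, c} = {p, q, r}" "r \<noteq> p" "r \<noteq> q"
  proof -
    have "\<exists>r. {a, b, c} = {p, q, r} \<and> r \<noteq> p \<and> r \<noteq> q"
      using pq_abc pq(1) d by (auto simp: insert_commute)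
    thus thesis using that by blast
  qed
  show ?thesis
  proof (cases "g r = g p")
    case True
    have "g x = g y \<longleftrightarrow> x = y \<or> {x, y} \<subseteq> {p, q, r}" for x y
      using True pq g[of x y] unfolding r(1) by auto
    moreover have "distinct [p, q, r]" using pq r by auto
    ultimately show ?thesis unfolding kernel_triple_def by blast
  next
    case False
    have "g x = g y \<longleftrightarrow> x = y \<or> {x, y} = {p, q}" for x y
      using False pq g[of x y] unfolding r(1) by (auto simp: doubleton_eq_iff)
    thus ?thesis using pq(1) unfolding kernel_pair_def by blast
  qed
qed

lemma kernel_two_pairs_comp:
  assumes "kernel_two_pairs (g \<circ> f)" "bij f"
  shows "kernel_two_pairs g"
proof -
  obtain a b c d where d: "distinct [a, b, c, d]"
    and gf: "\<And>x y. g (f x) = g (f y) \<longleftrightarrow> x = y \<or> {x, y} = {a, b} \<or> {x, y} = {c, d}"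
    using assms(1) by (auto simp: kernel_two_pairs_def)
  have inj: "f x = f y \<longleftrightarrow> x = y" for x y using assms(2) by (simp add: bij_is_inj inj_eq)
  have "g x = g y \<longleftrightarrow> x = y \<or> {x, y} = {f a, f b} \<or> {x, y} = {f c, f d}" for x y
  proof -
    obtain x' y' where "x = f x'" "y = f y'" using assms(2) by (metis bij_pointE)
    thus ?thesis using gf[of x' y'] by (simp add: doubleton_eq_iff inj)
  qed
  moreover have "distinct [f a, f b, f c, f d]" using d by (simp add: inj)
  ultimately show ?thesis unfolding kernel_two_pairs_def by blast
qed

lemma kernel_triple_comp:
  assumes "kernel_triple (g \<circ> f)" "bij f"
  shows "kernel_triple g"
proof -
  obtain a b c where d: "distinct [a, b, c]"
    and gf': "\<forall>x y. (g \<circ> f) x = (g \<circ> f) y \<longleftrightarrow> x = y \<or> {x, y} \<subseteq> {a, b, c}"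
    using assms(1) unfolding kernel_triple_def by (elim exE conjE)
  have gf: "g (f x) = g (f y) \<longleftrightarrow> x = y \<or> {x, y} \<subseteq> {a, b, c}" for x y
    using gf'[rule_format, of x y] by simp
  have inj: "f x = f y \<longleftrightarrow> x = y" for x y using assms(2) by (simp add: bij_is_inj inj_eq)
  have "g x = g y \<longleftrightarrow> x = y \<or> {x, y} \<subseteq> {f a, f b, f c}" for x y
  proof -
    obtain x' y' where "x = f x'" "y = f y'" using assms(2) by (metis bij_pointE)
    thus ?thesis using gf[of x' y'] by (simp add: inj)
  qed
  moreover have "distinct [f a, f b, f c]" using d by (simp add: inj)
  ultimately show ?thesis unfolding kernel_triple_def by blast
qed

text \<open>A point of a triple has two partners in its class, a point of a pair only one.\<close>

lemma kernel_two_pairs_not_triple: "kernel_two_pairs f \<Longrightarrow> \<not> kernel_triple f"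
proof
  assume "kernel_two_pairs f" "kernel_triple f"
  then obtain a b c d p q r where d: "distinct [p, q, r]" and abcd: "distinct [a, b, c, d]"
    and f: "\<forall>x y. f x = f y \<longleftrightarrow> x = y \<or> {x, y} = {a, b} \<or> {x, y} = {c, d}"
      "\<forall>x y. f x = f y \<longleftrightarrow> x = y \<or> {x, y} \<subseteq> {p, q, r}"
    unfolding kernel_two_pairs_def kernel_triple_def by (elim exE conjE)
  have "f p = f q" "f p = f r" using f(2) by simp_all
  hence "{p, q} = {a, b} \<or> {p, q} = {c, d}" "{p, r} = {a, b} \<or> {p, r} = {c, d}"
    using f(1)[rule_format, of p q] f(1)[rule_format, of p r] d by simp_all
  hence "p = a \<and> q = b \<or> p = b \<and> q = a \<or> p = c \<and> q = d \<or> p = d \<and> q = c"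
    "p = a \<and> r = b \<or> p = b \<and> r = a \<or> p = c \<and> r = d \<or> p = d \<and> r = c"
    unfolding doubleton_eq_iff by argo+
  thus False using d abcd by (elim disjE) simp_all
qed

text \<open>Dropping b and d from the domain keeps the image, since a and c take their places. The
  case c = a is allowed, so the lemma serves both two pairs and a triple.\<close>

lemma card_image_two_collisions:
  assumes f: "f \<in> transfs n" and ab: "f a = f b" "f c = f d" and d: "distinct [a, b, d]" "c \<notin> {b, d}"
  shows "card (f ` {1..n}) + 2 \<le> n"
proof -
  \<comment> \<open>Outside {1..n} the map is the identity and it preserves {1..n}, so collisions
    occur only inside.\<close>
  have mem: "x \<in> {1..n}" if "f x = f y" "x \<noteq> y" for x y
  proof (rule ccontr)
    assume "x \<notin> {1..n}"
    hence fy: "f y = x" using f that by (simp add: transfs_def)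
    moreover have "f y \<in> {1..n} \<or> f y = y" using f by (auto simp: transfs_def image_subset_iff)
    ultimately show False using \<open>x \<notin> {1..n}\<close> \<open>x \<noteq> y\<close> by metis
  qed
  have *: "a \<in> {1..n}" "b \<in> {1..n}" "c \<in> {1..n}" "d \<in> {1..n}"
    using mem[of a b] mem[of b a] mem[of c d] mem[of d c] ab d by auto
  have "f ` {1..n} \<subseteq> f ` ({1..n} - {b, d})"
  proof
    fix y assume "y \<in> f ` {1..n}"
    then obtain x where x: "x \<in> {1..n}" "y = f x" by blast
    have "y = f (if x = b then a else if x = d then c else x)" using x ab by simp
    moreover have "(if x = b then a else if x = d then c else x) \<in> {1..n} - {b, d}"
      using x * d by simp
    ultimately show "y \<in> f ` ({1..n} - {b, d})" by (rule image_eqI)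
  qed
  hence "card (f ` {1..n}) \<le> card (f ` ({1..n} - {b, d}))" by (intro card_mono) auto
  also have "\<dots> \<le> card ({1..n} - {b, d})" by (rule card_image_le) simp
  also have "\<dots> = n - 2" using * d by (subst card_Diff_subset) auto
  finally have "card (f ` {1..n}) \<le> n - 2" .
  moreover have "card {b, d} \<le> card {1..n}" using * by (intro card_mono) auto
  ultimately show ?thesis using d by simp
qed

lemma kernel_two_pairs_rank:
  assumes "f \<in> transfs n" "kernel_two_pairs f"
  shows "card (f ` {1..n}) + 2 \<le> n"
proof -
  obtain a b c d where d: "distinct [a, b, c, d]"
    and f: "\<And>x y. f x = f y \<longleftrightarrow> x = y \<or> {x, y} = {a, b} \<or> {x, y} = {c, d}"
    using assms(2) by (auto simp: kernel_two_pairs_def)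
  show ?thesis
    by (rule card_image_two_collisions[OF assms(1), of a b c d]) (use d f in auto)
qed

lemma kernel_triple_rank:
  assumes "f \<in> transfs n" "kernel_triple f"
  shows "card (f ` {1..n}) + 2 \<le> n"
proof -
  obtain a b c where d: "distinct [a, b, c]"
    and f: "\<forall>x y. f x = f y \<longleftrightarrow> x = y \<or> {x, y} \<subseteq> {a, b, c}"
    using assms(2) unfolding kernel_triple_def by (elim exE conjE)
  show ?thesis
    by (rule card_image_two_collisions[OF assms(1), of a b a c]) (use d f in auto)
qed

section \<open>Ranks and invariants of words\<close>

lemma transfs_rank_less: "f \<in> transfs n \<Longrightarrow> \<not> inj f \<Longrightarrow> card (f ` {1..n}) < n"
  by (metis card_atLeastAtMost card_image_le diff_Suc_1 eq_card_imp_inj_on finite_atLeastAtMost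
      inj_on_transfs_permutes nat_less_le permutes_inj)

lemma rank_comp_le:
  assumes "f \<in> transfs n" "g \<in> transfs n"
  shows "card ((g \<circ> f) ` {1..n}) \<le> card (f ` {1..n})" "card ((g \<circ> f) ` {1..n}) \<le> card (g ` {1..n})"
proof -
  show "card ((g \<circ> f) ` {1..n}) \<le> card (f ` {1..n})"
    unfolding image_comp[symmetric] by (rule card_image_le) simp
  have "(g \<circ> f) ` {1..n} \<subseteq> g ` {1..n}"
    unfolding image_comp[symmetric] using assms(1) by (intro image_mono) (simp add: transfs_def)
  thus "card ((g \<circ> f) ` {1..n}) \<le> card (g ` {1..n})" by (intro card_mono) auto
qed

text \<open>The value of the shortest prefix that represents a non-unit, or of the whole word if there is none.\<close>

primrec first_singular :: "('x \<Rightarrow> nat \<Rightarrow> nat) \<Rightarrow> 'x list \<Rightarrow> nat \<Rightarrow> nat" where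
  "first_singular \<phi> [] = id"
| "first_singular \<phi> (x # w) = (if inj (\<phi> x) then first_singular \<phi> w \<circ> \<phi> x else \<phi> x)"

definition singular_count :: "('x \<Rightarrow> nat \<Rightarrow> nat) \<Rightarrow> 'x list \<Rightarrow> int" where
  "singular_count \<phi> w = int (length (filter (\<lambda>x. \<not> inj (\<phi> x)) w))"

definition odd_count :: "('x \<Rightarrow> nat \<Rightarrow> nat) \<Rightarrow> 'x list \<Rightarrow> int" where
  "odd_count \<phi> w = int (length (filter (\<lambda>x. inj (\<phi> x) \<and> \<not> evenperm (\<phi> x)) w))"

lemma singular_count_append: "singular_count \<phi> (u @ v) = singular_count \<phi> u + singular_count \<phi> v"
  by (simp add: singular_count_def)

lemma odd_count_append: "odd_count \<phi> (u @ v) = odd_count \<phi> u + odd_count \<phi> v"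
  by (simp add: odd_count_def)

context
  fixes n :: nat and X :: "'x set" and \<phi> :: "'x \<Rightarrow> nat \<Rightarrow> nat"
  assumes \<phi>: "\<phi> ` X \<subseteq> transfs n"
begin

lemma letter_transfs: "x \<in> X \<Longrightarrow> \<phi> x \<in> transfs n"
  using \<phi> by blast

lemma inj_word_map_Cons:
  "x \<in> X \<Longrightarrow> w \<in> lists X \<Longrightarrow> inj (word_map \<phi> (x # w)) \<longleftrightarrow> inj (\<phi> x) \<and> inj (word_map \<phi> w)"
  unfolding word_map_Cons by (rule inj_comp_iff[OF letter_transfs word_map_transfs[OF \<phi>]])

lemma first_singular_append:
  assumes "u \<in> lists X" "v \<in> lists X"
  shows "first_singular \<phi> (u @ v)
    = (if inj (word_map \<phi> u) then first_singular \<phi> v \<circ> word_map \<phi> u else first_singular \<phi> u)"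
  using assms(1)
proof (induction u)
  case Nil
  show ?case by (simp add: word_map_Nil fun_eq_iff)
next
  case (Cons x u)
  hence x: "x \<in> X" "u \<in> lists X" by auto
  note IH = Cons.IH and iff = inj_word_map_Cons[OF x]
  show ?case
    unfolding iff unfolding append_Cons first_singular.simps IH word_map_Cons
    by (cases "inj (\<phi> x)"; cases "inj (word_map \<phi> u)") (simp_all only: if_True if_False simp_thms comp_assoc)
qed

lemma kernel_first_singular:
  "w \<in> lists X \<Longrightarrow> kernel_le (first_singular \<phi> w) (word_map \<phi> w)"
proof (induction w rule: lists.induct)
  case Nil
  show ?case by (simp add: word_map_Nil kernel_le_def)
next
  case (Cons x w)
  show ?case
  proof (cases "inj (\<phi> x)")
    case True
    have "kernel_le (first_singular \<phi> w \<circ> \<phi> x) (word_map \<phi> w \<circ> \<phi> x)"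
      using Cons.IH unfolding kernel_le_def comp_apply by blast
    thus ?thesis using True by (simp only: first_singular.simps word_map_Cons if_True)
  next
    case False
    thus ?thesis by (simp only: first_singular.simps word_map_Cons if_False kernel_le_comp)
  qed
qed

lemma inj_first_singular:
  assumes "w \<in> lists X"
  shows "inj (first_singular \<phi> w) \<longleftrightarrow> inj (word_map \<phi> w)"
  using assms
proof (induction w rule: lists.induct)
  case Nil
  show ?case by (simp only: word_map_Nil first_singular.simps)
next
  case (Cons x w)
  hence x: "x \<in> X" "w \<in> lists X" by auto
  show ?case
  proof (cases "inj (\<phi> x)")
    case True
    hence bij: "bij (\<phi> x)"
      using inj_transfs_permutes[OF letter_transfs[OF x(1)]] permutes_bij by blast
    have "inj (first_singular \<phi> w \<circ> \<phi> x) \<longleftrightarrow> inj (first_singular \<phi> w)"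
    proof
      assume "inj (first_singular \<phi> w \<circ> \<phi> x)"
      hence "inj_on (first_singular \<phi> w) (range (\<phi> x))" by (rule inj_on_imageI)
      thus "inj (first_singular \<phi> w)" using bij by (simp add: bij_is_surj)
    qed (use True in \<open>auto intro: inj_compose\<close>)
    thus ?thesis using True Cons.IH inj_word_map_Cons[OF x] by (simp only: first_singular.simps if_True simp_thms)
  next
    case False
    thus ?thesis using inj_word_map_Cons[OF x] by (simp only: first_singular.simps if_False simp_thms)
  qed
qed

text \<open>The kernel of the prefix is nontrivial and lies below that of the whole word, which is
  an atom.\<close>

lemma first_singular_kernel_pair:
  assumes "w \<in> lists X" "kernel_pair (word_map \<phi> w)"
  shows "same_kernel (first_singular \<phi> w) (word_map \<phi> w)"
proof (rule kernel_pair_minimal[OF assms(2) kernel_first_singular[OF assms(1)]])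
  have "\<not> inj (word_map \<phi> w)" using assms(2) by (rule kernel_not_inj)
  thus "\<not> inj (first_singular \<phi> w)" by (simp add: inj_first_singular[OF assms(1)])
qed

text \<open>Relations of other kernel types preserve the kernel of the first singular prefix of a word whose
  value has kernel type \<open>P\<close>.\<close>

lemma first_singular_invariant:
  assumes ker: "word_kernel \<phi> X = generated_congruence X Q" and Q: "Q \<subseteq> lists X \<times> lists X"
    and below: "\<And>f g. P f \<Longrightarrow> kernel_le g f \<Longrightarrow> \<not> inj g \<Longrightarrow> P g \<or> kernel_pair g"
    and P_comp: "\<And>f g. P (g \<circ> f) \<Longrightarrow> bij f \<Longrightarrow> P g"
    and no_rel: "\<And>u v. (u, v) \<in> Q \<Longrightarrow> \<not> P (word_map \<phi> u)"
    and uv: "(u, v) \<in> word_kernel \<phi> X" "P (word_map \<phi> u)"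
  shows "same_kernel (first_singular \<phi> u) (first_singular \<phi> v)"
proof -
  \<comment> \<open>The claim is itself turned into a congruence; once E is known to contain Q, it
    contains the whole kernel.\<close>
  define E where "E = {(u, v) \<in> word_kernel \<phi> X.
    P (word_map \<phi> u) \<longrightarrow> same_kernel (first_singular \<phi> u) (first_singular \<phi> v)}"
  have E_iff: "(u, v) \<in> E \<longleftrightarrow> u \<in> lists X \<and> v \<in> lists X \<and> word_map \<phi> u = word_map \<phi> v \<and>
    (P (word_map \<phi> u) \<longrightarrow> same_kernel (first_singular \<phi> u) (first_singular \<phi> v))" for u v
    unfolding E_def word_kernel_def by blast
  have "word_congruence X E"
  proof (rule word_congruenceI)
    show "E \<subseteq> lists X \<times> lists X" using E_iff by auto
    show "(u, u) \<in> E" if "u \<in> lists X" for u using that by (simp add: E_iff same_kernel_def)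
    show "(v, u) \<in> E" if "(u, v) \<in> E" for u v using that by (simp add: E_iff same_kernel_def)
    show "(u, w) \<in> E" if "(u, v) \<in> E" "(v, w) \<in> E" for u v w
      using that by (simp add: E_iff same_kernel_def)
    show "(u @ u', v @ v') \<in> E" if uv: "(u, v) \<in> E" and uv': "(u', v') \<in> E" for u v u' v'
    proof -
      have l: "u \<in> lists X" "v \<in> lists X" "u' \<in> lists X" "v' \<in> lists X"
        and eq: "word_map \<phi> u = word_map \<phi> v" "word_map \<phi> u' = word_map \<phi> v'"
        using uv uv' by (auto simp: E_iff)
      have "same_kernel (first_singular \<phi> (u @ u')) (first_singular \<phi> (v @ v'))"
        if P: "P (word_map \<phi> u' \<circ> word_map \<phi> u)"
      proof (cases "inj (word_map \<phi> u)")
        case True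
        hence "bij (word_map \<phi> u)"
          using inj_transfs_permutes[OF word_map_transfs[OF \<phi> l(1)]] permutes_bij by blast
        hence "P (word_map \<phi> u')" using P P_comp by blast
        hence "same_kernel (first_singular \<phi> u') (first_singular \<phi> v')" using uv' by (simp add: E_iff)
        thus ?thesis using True l eq(1) by (simp add: first_singular_append same_kernel_def)
      next
        case False
        \<comment> \<open>Here the first singular prefix lies within u. Either u has type P and the
          assumption on u and v applies, or its kernel is a pair and already determines the kernel
          of the prefix.\<close>
        have "same_kernel (first_singular \<phi> u) (first_singular \<phi> v)"
        proof (cases "P (word_map \<phi> u)")
          case True
          thus ?thesis using uv by (simp add: E_iff)
        next
          case False': False
          hence pair: "kernel_pair (word_map \<phi> u)"
            using below[OF P kernel_le_comp False] by blast
          show ?thesis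
            using first_singular_kernel_pair[OF l(1) pair]
              first_singular_kernel_pair[OF l(2) pair[unfolded eq(1)]] eq(1)
            by (simp add: same_kernel_def)
        qed
        thus ?thesis using False l eq(1) by (simp add: first_singular_append)
      qed
      thus ?thesis using l eq by (simp add: E_iff word_map_append)
    qed
  qed
  moreover have "Q \<subseteq> E"
  proof
    fix q assume "q \<in> Q"
    moreover have "Q \<subseteq> word_kernel \<phi> X" unfolding ker by (auto simp: generated_congruence_def)
    ultimately show "q \<in> E" using no_rel unfolding E_def by blast
  qed
  ultimately have "word_kernel \<phi> X \<subseteq> E" unfolding ker by (rule generated_congruence_least)
  thus ?thesis using uv E_iff by blast
qed

lemma singular_count_pos:
  "w \<in> lists X \<Longrightarrow> \<not> inj (word_map \<phi> w) \<Longrightarrow> singular_count \<phi> w > 0"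
proof (induction w rule: lists.induct)
  case Nil thus ?case by (simp only: word_map_Nil inj_on_id not_True_eq_False)
next
  case (Cons x w)
  hence x: "x \<in> X" "w \<in> lists X" by auto
  show ?case
  proof (cases "inj (\<phi> x)")
    case True
    hence "\<not> inj (word_map \<phi> w)" using Cons.prems inj_word_map_Cons[OF x] by blast
    thus ?thesis using True Cons.IH by (simp add: singular_count_def)
  qed (simp add: singular_count_def)
qed

text \<open>A product of transformations is a unit only if every factor is, and then parity is a
  homomorphism.\<close>

lemma unit_counts:
  assumes "w \<in> lists X" "inj (word_map \<phi> w)"
  shows "singular_count \<phi> w = 0 \<and> (even (odd_count \<phi> w) \<longleftrightarrow> evenperm (word_map \<phi> w))"
  using assms
proof (induction w rule: lists.induct)
  case Nil
  show ?case using evenperm_id by (simp add: singular_count_def odd_count_def word_map_def)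
next
  case (Cons x w)
  hence x: "x \<in> X" "w \<in> lists X" by auto
  hence inj: "inj (\<phi> x)" "inj (word_map \<phi> w)" using Cons.prems inj_word_map_Cons by auto
  have "permutation (word_map \<phi> w)" "permutation (\<phi> x)"
    using inj_transfs_permutes[OF word_map_transfs[OF \<phi> x(2)] inj(2)]
      inj_transfs_permutes[OF letter_transfs[OF x(1)] inj(1)] permutes_imp_permutation[of "{1..n}"]
    by auto
  hence "evenperm (word_map \<phi> (x # w)) \<longleftrightarrow> evenperm (word_map \<phi> w) = evenperm (\<phi> x)"
    unfolding word_map_Cons by (rule evenperm_comp)
  thus ?case using Cons.IH inj
    by (auto simp: singular_count_def odd_count_def)
qed

text \<open>The numbers of odd letters modulo 2 and of singular letters take values in \<open>\<int>/2 \<times> \<int>\<close>, which is not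
  cyclic, so one relation of rank \<open>n - 1\<close> is not enough.\<close>

lemma not_single_relation_of_corank_one:
  assumes ker: "word_kernel \<phi> X = generated_congruence X Q"
    and onto: "word_map \<phi> ` lists X = transfs n" and n: "2 \<le> n"
    and only: "\<And>r. r \<in> Q \<Longrightarrow> card (word_map \<phi> (fst r) ` {1..n}) = n - 1 \<Longrightarrow> r = r0"
  shows False
proof -
  \<comment> \<open>The change of the two counts across the only available relation of rank n - 1.
    \<open>C\<close> says that the counts of u and v differ by a multiple of this change, that is,
    by an element of the cyclic subgroup generated by (m, d).\<close>
  define m d where "m = singular_count \<phi> (fst r0) - singular_count \<phi> (snd r0)"
    and "d = odd_count \<phi> (fst r0) - odd_count \<phi> (snd r0)"
  define C where "C u v \<longleftrightarrow> (\<exists>j. singular_count \<phi> u - singular_count \<phi> v = j * m \<and>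
    even (odd_count \<phi> u - odd_count \<phi> v - j * d))" for u v
  define E where "E = {(u, v) \<in> word_kernel \<phi> X. n - 1 \<le> card (word_map \<phi> u ` {1..n}) \<longrightarrow> C u v}"
  have E_iff: "(u, v) \<in> E \<longleftrightarrow> u \<in> lists X \<and> v \<in> lists X \<and> word_map \<phi> u = word_map \<phi> v \<and>
    (n - 1 \<le> card (word_map \<phi> u ` {1..n}) \<longrightarrow> C u v)" for u v
    unfolding E_def word_kernel_def by blast
  have C_refl: "C u u" for u unfolding C_def by (rule exI[of _ 0]) simp
  have C_sym: "C v u" if C: "C u v" for u v
  proof -
    obtain j where "singular_count \<phi> u - singular_count \<phi> v = j * m"
      "even (odd_count \<phi> u - odd_count \<phi> v - j * d)" using C unfolding C_def by blast
    hence "singular_count \<phi> v - singular_count \<phi> u = (- j) * m"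
      "even (odd_count \<phi> v - odd_count \<phi> u - (- j) * d)" by auto
    thus ?thesis unfolding C_def by blast
  qed
  have C_trans: "C u w" if C: "C u v" "C v w" for u v w
  proof -
    obtain j k where "singular_count \<phi> u - singular_count \<phi> v = j * m"
      "even (odd_count \<phi> u - odd_count \<phi> v - j * d)" "singular_count \<phi> v - singular_count \<phi> w = k * m"
      "even (odd_count \<phi> v - odd_count \<phi> w - k * d)" using C unfolding C_def by blast
    hence "singular_count \<phi> u - singular_count \<phi> w = (j + k) * m"
      "even (odd_count \<phi> u - odd_count \<phi> w - (j + k) * d)" by (auto simp: distrib_right)
    thus ?thesis unfolding C_def by blast
  qed
  have C_append: "C (u @ u') (v @ v')" if C: "C u v" "C u' v'" for u v u' v'
  proof -
    obtain j k where "singular_count \<phi> u - singular_count \<phi> v = j * m"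
      "even (odd_count \<phi> u - odd_count \<phi> v - j * d)" "singular_count \<phi> u' - singular_count \<phi> v' = k * m"
      "even (odd_count \<phi> u' - odd_count \<phi> v' - k * d)" using C unfolding C_def by blast
    hence "singular_count \<phi> (u @ u') - singular_count \<phi> (v @ v') = (j + k) * m"
      "even (odd_count \<phi> (u @ u') - odd_count \<phi> (v @ v') - (j + k) * d)"
      unfolding singular_count_append odd_count_append by (auto simp: distrib_right)
    thus ?thesis unfolding C_def by blast
  qed
  have "word_congruence X E"
  proof (rule word_congruenceI)
    show "E \<subseteq> lists X \<times> lists X" using E_iff by auto
    show "(u, u) \<in> E" if "u \<in> lists X" for u using that C_refl by (simp add: E_iff)
    show "(v, u) \<in> E" if "(u, v) \<in> E" for u v using that C_sym by (simp add: E_iff)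
    show "(u, w) \<in> E" if "(u, v) \<in> E" "(v, w) \<in> E" for u v w
      using that C_trans[of u v w] by (auto simp: E_iff)
    show "(u @ u', v @ v') \<in> E" if uv: "(u, v) \<in> E" and uv': "(u', v') \<in> E" for u v u' v'
    proof -
      have l: "u \<in> lists X" "v \<in> lists X" "u' \<in> lists X" "v' \<in> lists X"
        and eq: "word_map \<phi> u = word_map \<phi> v" "word_map \<phi> u' = word_map \<phi> v'"
        using uv uv' by (auto simp: E_iff)
      \<comment> \<open>A product has at most the rank of each factor, so both factors fall under
        the rank condition in E.\<close>
      note le = rank_comp_le[OF word_map_transfs[OF \<phi> l(1)] word_map_transfs[OF \<phi> l(3)]]
      have "C (u @ u') (v @ v')" if "n - 1 \<le> card ((word_map \<phi> u' \<circ> word_map \<phi> u) ` {1..n})"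
        using order.trans[OF that le(1)] order.trans[OF that le(2)] uv uv' C_append
        by (simp add: E_iff)
      thus ?thesis using l eq unfolding E_iff word_map_append by simp
    qed
  qed
  moreover have "Q \<subseteq> E"
  proof
    fix q assume q: "q \<in> Q"
    moreover have "Q \<subseteq> word_kernel \<phi> X" unfolding ker by (auto simp: generated_congruence_def)
    ultimately have l: "fst q \<in> lists X" "snd q \<in> lists X" "word_map \<phi> (fst q) = word_map \<phi> (snd q)"
      by (auto simp: word_kernel_def)
    \<comment> \<open>Between units the singular counts vanish and the parities agree, so the
      multiple is 0; the relation \<open>r0\<close> itself has multiple 1.\<close>
    have "C (fst q) (snd q)" if rank: "n - 1 \<le> card (word_map \<phi> (fst q) ` {1..n})"
    proof (cases "inj (word_map \<phi> (fst q))")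
      case True
      thus ?thesis using unit_counts[OF l(1)] unit_counts[OF l(2)] l(3)
        unfolding C_def by (intro exI[of _ 0]) simp
    next
      case False
      hence "card (word_map \<phi> (fst q) ` {1..n}) = n - 1"
        using transfs_rank_less[OF word_map_transfs[OF \<phi> l(1)]] rank by fastforce
      hence "q = r0" using only q by blast
      thus ?thesis unfolding C_def m_def d_def by (intro exI[of _ 1]) simp
    qed
    thus "q \<in> E" using l E_iff[of "fst q" "snd q"] by simp
  qed
  ultimately have "word_kernel \<phi> X \<subseteq> E" unfolding ker by (rule generated_congruence_least)
  hence CI: "C u v" if "u \<in> lists X" "v \<in> lists X" "word_map \<phi> u = word_map \<phi> v"
    "card (word_map \<phi> v ` {1..n}) = n - 1" for u v
  proof -
    have "(u, v) \<in> word_kernel \<phi> X" using that by (simp add: word_kernel_def)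
    thus ?thesis using \<open>word_kernel \<phi> X \<subseteq> E\<close> that by (auto simp: E_iff)
  qed
  obtain w where w: "zeta_map = word_map \<phi> w" "w \<in> lists X"
    using zeta_map_transfs[OF n] unfolding onto[symmetric] by (rule imageE)
  have tr: "transpose 1 2 permutes {1..n}" using n by (intro permutes_swap_id) auto
  obtain s where s: "transpose 1 2 = word_map \<phi> s" "s \<in> lists X"
    using permutes_transfs[OF tr] unfolding onto[symmetric] by (rule imageE)
  have rank: "card (word_map \<phi> w ` {1..n}) = n - 1"
  proof -
    have "zeta_map ` {1..n} = {1..n} - {2}"
    proof (intro equalityI subsetI)
      fix y assume "y \<in> {1..n} - {2::nat}"
      hence "y = zeta_map y" "y \<in> {1..n}" by (auto simp: zeta_map_def)
      thus "y \<in> zeta_map ` {1..n}" by (rule image_eqI)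
    qed (use n in \<open>auto simp: zeta_map_def split: if_splits\<close>)
    thus ?thesis using n by (simp add: w(1)[symmetric])
  qed
  have "word_map \<phi> (s @ w) = word_map \<phi> w"
    by (auto simp: word_map_append fun_eq_iff transpose_def zeta_map_def simp flip: s(1) w(1))
  hence "C (s @ w) w" using s w rank by (intro CI) auto
  moreover have "word_map \<phi> (w @ w) = word_map \<phi> w"
    by (auto simp: word_map_append fun_eq_iff zeta_map_def simp flip: w(1))
  hence "C (w @ w) w" using w rank by (intro CI) auto
  \<comment> \<open>Absorbing \<open>s\<close> changes the counts by (0, odd), absorbing a second w
    by a positive number of singular letters. The latter forces m to be nonzero, so j = 0, and the
    odd count would be even.\<close>
  ultimately obtain j k where "singular_count \<phi> s = j * m" "even (odd_count \<phi> s - j * d)"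
    "singular_count \<phi> w = k * m" unfolding C_def singular_count_append odd_count_append by auto
  moreover have "singular_count \<phi> s = 0" "odd (odd_count \<phi> s)"
    using unit_counts[OF s(2)] by (auto simp: evenperm_swap simp flip: s(1))
  moreover have "singular_count \<phi> w > 0"
  proof (rule singular_count_pos[OF w(2)])
    have "zeta_map 1 = zeta_map 2" "(1::nat) \<noteq> 2" by (auto simp: zeta_map_def)
    thus "\<not> inj (word_map \<phi> w)" unfolding w(1)[symmetric] by (metis injD)
  qed
  ultimately show False by auto
qed

end

text \<open>Four different members of S are exhibited: one for each kernel type of rank n - 2 and
  two of rank n - 1. Relations in R have unit values and cannot take their place.\<close>

lemma presentation_relations_lower_bound:
  fixes A :: "'a set"
  assumes n: "4 \<le> n" and pres: "monoid_presentation (full_transf_monoid n) (A \<union> B) (R \<union> S) \<phi>"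
    and sym: "monoid_presentation (symmetric_group n) A R \<phi>"
  shows "4 \<le> card S"
proof -
  let ?X = "A \<union> B"
  have finS: "finite S" and Q: "R \<union> S \<subseteq> lists ?X \<times> lists ?X" and \<phi>: "\<phi> ` ?X \<subseteq> transfs n"
    and onto: "word_map \<phi> ` lists ?X = transfs n"
    and ker: "word_kernel \<phi> ?X = generated_congruence ?X (R \<union> S)"
    using pres by (simp_all add: presentation_transf_iff)
  have R_units: "word_map \<phi> (fst r) permutes {1..n}" if "r \<in> R" for r
  proof -
    have "R \<subseteq> lists A \<times> lists A" "word_map \<phi> ` lists A = {p. p permutes {1..n}}"
      using sym by (simp_all add: presentation_symmetric_iff)
    thus ?thesis using that by (metis imageI mem_Collect_eq mem_Times_iff subsetD)
  qed
  have word: "\<exists>w \<in> lists ?X. word_map \<phi> w = f" if "f \<in> transfs n" for f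
    using that unfolding onto[symmetric] by blast
  have S_lists: "fst r \<in> lists ?X" if "r \<in> S" for r 
    using Q that by (metis UnI2 mem_Times_iff subsetD)
  \<comment> \<open>The words uv and vu have equal value of type P, but their first singular
    prefixes have the kernels of f and of g. Without a relation of type P in S these kernels would
    have to agree.\<close>
  have commuting: "\<exists>r\<in>S. P (word_map \<phi> (fst r))"
    if below: "\<And>f g. P f \<Longrightarrow> kernel_le g f \<Longrightarrow> \<not> inj g \<Longrightarrow> P g \<or> kernel_pair g"
      and P_comp: "\<And>f g. P (g \<circ> f) \<Longrightarrow> bij f \<Longrightarrow> P g" and P_inj: "\<And>f. P f \<Longrightarrow> \<not> inj f"
      and fg: "f \<in> transfs n" "g \<in> transfs n" "g \<circ> f = f \<circ> g" "P (g \<circ> f)"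
      and pairs: "kernel_pair f" "kernel_pair g" and diff: "\<not> same_kernel f g" for P f g
  proof (rule ccontr)
    assume no: "\<not> (\<exists>r\<in>S. P (word_map \<phi> (fst r)))"
    obtain u v where u: "u \<in> lists ?X" "word_map \<phi> u = f" and v: "v \<in> lists ?X" "word_map \<phi> v = g"
      using word fg(1,2) by metis
    have sing: "\<not> inj f" "\<not> inj g" using pairs by (simp_all add: kernel_not_inj)
    have "same_kernel (first_singular \<phi> (u @ v)) (first_singular \<phi> (v @ u))"
    proof (rule first_singular_invariant[OF \<phi> ker Q, where P = P])
      show "P g \<or> kernel_pair g" if "P f" "kernel_le g f" "\<not> inj g" for f g
        using that by (rule below)
      show "P g" if "P (g \<circ> f)" "bij f" for f g using that by (rule P_comp)
      show "\<not> P (word_map \<phi> u)" if "(u, v) \<in> R \<union> S" for u v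
        using that no P_inj R_units permutes_inj by fastforce
      show "(u @ v, v @ u) \<in> word_kernel \<phi> ?X" using u v fg(3) by (simp add: word_kernel_def word_map_append)
      show "P (word_map \<phi> (u @ v))" using u v fg(4) by (simp add: word_map_append)
    qed
    hence "same_kernel (first_singular \<phi> u) (first_singular \<phi> v)"
      using u v sing by (simp add: first_singular_append[OF \<phi>])
    hence "same_kernel f g"
      using first_singular_kernel_pair[OF \<phi> u(1)] first_singular_kernel_pair[OF \<phi> v(1)] pairs u(2) v(2)
      by (simp add: same_kernel_def)
    thus False using diff by contradiction
  qed
  define e where "e i j = id(j := i)" for i j :: nat
  have e_transfs: "e i j \<in> transfs n" if "i \<in> {1..n}" "j \<in> {1..n}" for i j
    using that by (auto simp: e_def transfs_def image_subset_iff)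
  have e_pair: "kernel_pair (e i j)" if "i \<noteq> j" for i j
  proof -
    have "e i j x = e i j y \<longleftrightarrow> x = y \<or> {x, y} = {i, j}" for x y
      using that by (auto simp: e_def doubleton_eq_iff)
    thus ?thesis using that unfolding kernel_pair_def by blast
  qed
  \<comment> \<open>Two idempotents on disjoint pairs commute; n \<ge> 4 provides the four
    points.\<close>
  have "\<exists>r\<in>S. kernel_two_pairs (word_map \<phi> (fst r))"
  proof (rule commuting[of kernel_two_pairs "e 1 2" "e 3 4"])
    have "(e 3 4 \<circ> e 1 2) x = (e 3 4 \<circ> e 1 2) y \<longleftrightarrow> x = y \<or> {x, y} = {1, 2} \<or> {x, y} = {3, 4}" for x y
      by (auto simp: e_def doubleton_eq_iff)
    moreover have "distinct [1, 2, 3, 4::nat]" by simp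
    ultimately show "kernel_two_pairs (e 3 4 \<circ> e 1 2)" unfolding kernel_two_pairs_def by blast
    show "kernel_two_pairs g \<or> kernel_pair g" if "kernel_two_pairs f" "kernel_le g f" "\<not> inj g" for f g
      using that by (rule kernel_two_pairs_below)
    show "\<not> inj f" if "kernel_two_pairs f" for f using that by (rule kernel_not_inj)
    have "e 1 2 1 = e 1 2 2" "e 3 4 1 \<noteq> e 3 4 2" by (auto simp: e_def)
    thus "\<not> same_kernel (e 1 2) (e 3 4)" unfolding same_kernel_def by blast
    show "e 3 4 \<circ> e 1 2 = e 1 2 \<circ> e 3 4" by (auto simp: e_def fun_eq_iff)
  qed (use n in \<open>auto intro: kernel_two_pairs_comp e_transfs e_pair\<close>)
  then obtain r1 where r1: "r1 \<in> S" "kernel_two_pairs (word_map \<phi> (fst r1))" by blast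
  \<comment> \<open>Two idempotents with common target 1 commute, and their product collapses {1, 2,
    3}.\<close>
  have "\<exists>r\<in>S. kernel_triple (word_map \<phi> (fst r))"
  proof (rule commuting[of kernel_triple "e 1 2" "e 1 3"])
    have "(e 1 3 \<circ> e 1 2) x = (e 1 3 \<circ> e 1 2) y \<longleftrightarrow> x = y \<or> {x, y} \<subseteq> {1, 2, 3}" for x y
      by (auto simp: e_def)
    moreover have "distinct [1, 2, 3::nat]" by simp
    ultimately show "kernel_triple (e 1 3 \<circ> e 1 2)" unfolding kernel_triple_def by blast
    show "kernel_triple g \<or> kernel_pair g" if "kernel_triple f" "kernel_le g f" "\<not> inj g" for f g
      using that by (rule kernel_triple_below)
    show "\<not> inj f" if "kernel_triple f" for f using that by (rule kernel_not_inj)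
    have "e 1 2 1 = e 1 2 2" "e 1 3 1 \<noteq> e 1 3 2" by (auto simp: e_def)
    thus "\<not> same_kernel (e 1 2) (e 1 3)" unfolding same_kernel_def by blast
    show "e 1 3 \<circ> e 1 2 = e 1 2 \<circ> e 1 3" by (auto simp: e_def fun_eq_iff)
  qed (use n in \<open>auto intro: kernel_triple_comp e_transfs e_pair\<close>)
  then obtain r2 where r2: "r2 \<in> S" "kernel_triple (word_map \<phi> (fst r2))" by blast
  define rank where "rank r = card (word_map \<phi> (fst r) ` {1..n})"
    for r :: "'a list \<times> 'a list"
  have rank_R: "rank r = n" if "r \<in> R" for r
    using permutes_image[OF R_units[OF that]] by (simp add: rank_def)
  \<comment> \<open>Leaving \<open>r0\<close> arbitrary allows two uses: the first yields some
    relation of rank n - 1, the second a relation different from it.\<close>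
  have more: "\<exists>r\<in>S. rank r = n - 1 \<and> r \<noteq> r0" for r0
  proof (rule ccontr)
    assume "\<not> (\<exists>r\<in>S. rank r = n - 1 \<and> r \<noteq> r0)"
    hence only: "r = r0" if "r \<in> R \<union> S" "card (word_map \<phi> (fst r) ` {1..n}) = n - 1" for r
      using that rank_R n unfolding rank_def by fastforce
    have "2 \<le> n" using n by simp
    thus False using only by (rule not_single_relation_of_corank_one[OF \<phi> ker onto])
  qed
  obtain r3 where r3: "r3 \<in> S" "rank r3 = n - 1" using more by blast
  obtain r4 where r4: "r4 \<in> S" "rank r4 = n - 1" "r4 \<noteq> r3" using more by blast
  have "rank r1 + 2 \<le> n" "rank r2 + 2 \<le> n"
    unfolding rank_def
    using kernel_two_pairs_rank[OF word_map_transfs[OF \<phi> S_lists[OF r1(1)]] r1(2)]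
      kernel_triple_rank[OF word_map_transfs[OF \<phi> S_lists[OF r2(1)]] r2(2)] by auto
  hence "r1 \<noteq> r3" "r1 \<noteq> r4" "r2 \<noteq> r3" "r2 \<noteq> r4" using r3 r4 n by auto
  moreover have "r1 \<noteq> r2" using r1(2) r2(2) kernel_two_pairs_not_triple by blast
  ultimately have "card {r1, r2, r3, r4} = 4" using r4(3) by simp
  moreover have "card {r1, r2, r3, r4} \<le> card S" using r1 r2 r3 r4 finS by (intro card_mono) auto
  ultimately show ?thesis by simp
qed

lemma cycle_of_list_pair: "cycle_of_list [a, b] = transpose a b"
  by simp

theorem theorem1p5:
  shows
    "(\<forall>(n::nat) (A::'a set) (R::('a list \<times> 'a list) set) (\<pi>::'a \<Rightarrow> nat \<Rightarrow> nat) (\<zeta>::'a).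
        n \<ge> 7 \<and> monoid_presentation (symmetric_group n) A R \<pi> \<and> \<zeta> \<notin> A \<longrightarrow>
        (let W = words_for (symmetric_group n) A \<pi>;
             Z = {[\<zeta>]};
             \<tau> = cycle_of_list [1, n] \<circ> cycle_of_list [2, 3];
             c12 = cycle_of_list [1, 2];
             c13 = cycle_of_list [1, 3];
             c23 = cycle_of_list [2, 3];
             \<alpha> = alpha n; \<alpha>' = inv_into UNIV \<alpha>;
             \<beta> = beta n; \<beta>' = inv_into UNIV \<beta>
         in \<forall>r1 \<in> word_products [W \<tau>, Z, W \<tau>, Z] \<times> word_products [Z, W \<tau>, Z, W \<tau>].
            \<forall>r2 \<in> word_products [W c23, Z, W c23, Z, W c23, Z, W c23] \<times> word_products [Z, W c23, Z].
            \<forall>r3 \<in> word_products [W \<alpha>', Z, W \<alpha>] \<times> word_products [Z, W c13, Z, W c13].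
            \<forall>r4 \<in> word_products [W \<beta>', Z, W \<beta>] \<times> word_products [W c12, Z, W c13, Z, W c13].
              monoid_presentation (full_transf_monoid n) (insert \<zeta> A)
                (R \<union> {r1, r2, r3, r4}) (\<pi>(\<zeta> := zeta_map))))
     \<and>
     (\<forall>(n::nat) (A::'b set) (B::'b set) (R::('b list \<times> 'b list) set)
        (S::('b list \<times> 'b list) set) (\<phi>::'b \<Rightarrow> nat \<Rightarrow> nat).
        n \<ge> 4 \<and> A \<inter> B = {} \<and>
        monoid_presentation (full_transf_monoid n) (A \<union> B) (R \<union> S) \<phi> \<and>
        monoid_presentation (symmetric_group n) A R \<phi> \<longrightarrow>
        card S \<ge> 4)"
proof (rule conjI; intro allI impI)
  fix n :: nat and A :: "'a set" and R :: "('a list \<times> 'a list) set" and \<pi> :: "'a \<Rightarrow> nat \<Rightarrow> nat" and \<zeta> :: 'a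
  assume *: "7 \<le> n \<and> monoid_presentation (symmetric_group n) A R \<pi> \<and> \<zeta> \<notin> A"
  define W where "W = words_for (symmetric_group n) A \<pi>"
  have W: "W p = {w \<in> lists A. word_map \<pi> w = p}" for p
    by (simp add: W_def words_for_def word_value_symmetric)
  show "let W = words_for (symmetric_group n) A \<pi>;
             Z = {[\<zeta>]};
             \<tau> = cycle_of_list [1, n] \<circ> cycle_of_list [2, 3];
             c12 = cycle_of_list [1, 2];
             c13 = cycle_of_list [1, 3];
             c23 = cycle_of_list [2, 3];
             \<alpha> = alpha n; \<alpha>' = inv_into UNIV \<alpha>;
             \<beta> = beta n; \<beta>' = inv_into UNIV \<beta>
         in \<forall>r1 \<in> word_products [W \<tau>, Z, W \<tau>, Z] \<times> word_products [Z, W \<tau>, Z, W \<tau>].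
            \<forall>r2 \<in> word_products [W c23, Z, W c23, Z, W c23, Z, W c23] \<times> word_products [Z, W c23, Z].
            \<forall>r3 \<in> word_products [W \<alpha>', Z, W \<alpha>] \<times> word_products [Z, W c13, Z, W c13].
            \<forall>r4 \<in> word_products [W \<beta>', Z, W \<beta>] \<times> word_products [W c12, Z, W c13, Z, W c13].
              monoid_presentation (full_transf_monoid n) (insert \<zeta> A)
                (R \<union> {r1, r2, r3, r4}) (\<pi>(\<zeta> := zeta_map))"
    unfolding Let_def W_def[symmetric] cycle_of_list_pair
  proof (intro ballI, goal_cases)
    case (1 r1 r2 r3 r4)
    obtain u1 u2 u3 u4 where u: "r1 = (u1 @ [\<zeta>] @ u2 @ [\<zeta>], [\<zeta>] @ u3 @ [\<zeta>] @ u4)"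
      "u1 \<in> W (transpose 1 n \<circ> transpose 2 3)" "u2 \<in> W (transpose 1 n \<circ> transpose 2 3)"
      "u3 \<in> W (transpose 1 n \<circ> transpose 2 3)" "u4 \<in> W (transpose 1 n \<circ> transpose 2 3)"
      using 1(1) unfolding word_products_Cons word_products_Nil by auto
    obtain v1 v2 v3 v4 v5 where v:
      "r2 = (v1 @ [\<zeta>] @ v2 @ [\<zeta>] @ v3 @ [\<zeta>] @ v4, [\<zeta>] @ v5 @ [\<zeta>])"
      "v1 \<in> W (transpose 2 3)" "v2 \<in> W (transpose 2 3)" "v3 \<in> W (transpose 2 3)"
      "v4 \<in> W (transpose 2 3)" "v5 \<in> W (transpose 2 3)"
      using 1(2) unfolding word_products_Cons word_products_Nil by auto
    obtain x1 x2 x3 x4 where x: "r3 = (x1 @ [\<zeta>] @ x2, [\<zeta>] @ x3 @ [\<zeta>] @ x4)"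
      "x1 \<in> W (pinv (alpha n))" "x2 \<in> W (alpha n)" "x3 \<in> W (transpose 1 3)" "x4 \<in> W (transpose 1 3)"
      using 1(3) unfolding word_products_Cons word_products_Nil by auto
    obtain y1 y2 y3 y4 y5 where y: "r4 = (y1 @ [\<zeta>] @ y2, y3 @ [\<zeta>] @ y4 @ [\<zeta>] @ y5)"
      "y1 \<in> W (pinv (beta n))" "y2 \<in> W (beta n)" "y3 \<in> W (transpose 1 2)" "y4 \<in> W (transpose 1 3)"
      "y5 \<in> W (transpose 1 3)"
      using 1(4) unfolding word_products_Cons word_products_Nil by auto
    show ?case
      unfolding u(1) v(1) x(1) y(1)
      by (rule four_relations_present_transfs[OF _ _ _ W u(2-) v(2-) x(2-) y(2-)]) (use * in auto)
  qed
next
  fix n :: nat and A B :: "'b set" and R S :: "('b list \<times> 'b list) set" and \<phi> :: "'b \<Rightarrow> nat \<Rightarrow> nat"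
  assume "4 \<le> n \<and> A \<inter> B = {} \<and> monoid_presentation (full_transf_monoid n) (A \<union> B) (R \<union> S) \<phi> \<and>
    monoid_presentation (symmetric_group n) A R \<phi>"
  thus "4 \<le> card S" using presentation_relations_lower_bound by blast
qed

end
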